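(* Let $\mathfrak g$ be a real solvable Lie algebra of dimension $2n$ whose nilradical $\mathfrak h$ is abelian and of codimension $2$, and let $(J,\langle\cdot,\cdot\rangle)$ be an almost Hermitian structure on $\mathfrak g$ with $J\mathfrak h=\mathfrak h$. Let $\{U,JU\}$ be an orthonormal basis of $\mathfrak h^\perp$, set $A:=\mathrm{ad}_U|_{\mathfrak h}$, $B:=\mathrm{ad}_{JU}|_{\mathfrak h}$, and let $J_{\mathfrak h}$, $\langle\cdot,\cdot\rangle_{\mathfrak h}$ be the restrictions of $J$, $\langle\cdot,\cdot\rangle$ to $\mathfrak h$. Then $(J,\langle\cdot,\cdot\rangle)$ is SKT if and only if one of the following equivalent conditions holds: (i) $A,B\in\mathfrak{so}(\mathfrak h)$ and $[A,J_{\mathfrak h}]=[B,J_{\mathfrak h}]=0$; (ii) there exists an orthonormal basis $\{e_1,\dots,e_{2n-2}\}$ of $(\mathfrak h,\langle\cdot,\cdot\rangle_{\mathfrak h})$ with respect to which $$J_{\mathfrak h}=\mathrm{diag}(\Lambda_1,\dots,\Lambda_{n-1}),\quad A=\mathrm{diag}(A_1,\dots,A_{n-1}),\quad B=\mathrm{diag}(B_1,\dots,B_{n-1})$$ (block diagonal), where $$\Lambda_i=\begin{pmatrix}0&-1\\1&0\end{pmatrix},\quad A_i=\begin{pmatrix}0&a_i\\-a_i&0\end{pmatrix},\quad B_i=\begin{pmatrix}0&b_i\\-b_i&0\end{pmatrix},\qquad a_i,b_i\in\mathbb R.$$ Moreover, if $(J,\langle\cdot,\cdot\rangle)$ is SKT,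 then: (iii) $(J,\langle\cdot,\cdot\rangle)$ is Kähler if and only if $[\mathfrak h^\perp,\mathfrak h^\perp]=0$; (iv) if $\mathfrak z(\mathfrak g)\cap\mathfrak h=\{0\}$, then $(\mathfrak g,J)$ admits also a Kähler metric.
   Context: All Lie algebras are real and finite-dimensional. The nilradical is the maximal nilpotent ideal; $\mathfrak z(\mathfrak g)$ is the center of $\mathfrak g$. An almost Hermitian structure on $\mathfrak g$ is a pair $(J,\langle\cdot,\cdot\rangle)$ with $J^2=-\mathrm{Id}$ and $\langle\cdot,\cdot\rangle$ an inner product with $\langle JX,JY\rangle=\langle X,Y\rangle$ (the inner product is then called $J$-Hermitian). $J$ is integrable if $[X,Y]+J([JX,Y]+[X,JY])-[JX,JY]=0$ for all $X,Y$; then the structure is Hermitian. Fundamental form $\omega=\langle J\cdot,\cdot\rangle$; $d$ is the Chevalley–Eilenberg differential ($d\alpha(X,Y)=-\alpha([X,Y])$ on $1$-forms). Bismut torsion: $c(X,Y,Z)=d\omega(JX,JY,JZ)$. The structure is SKT if $J$ is integrable and $dc=0$; it is Kähler if $J$ is integrable and $d\omega=0$. A Kähler metric on $(\mathfrak g,J)$ is a $J$-Hermitian inner product whose fundamental form is closed. $\mathfrak{so}(\mathfrak h)$ denotes the endomorphisms of $\mathfrak h$ skew-symmetric with respect to $\langle\cdot,\cdot\rangle_{\mathfrak h}$; brackets of endomorphisms are commutators. *)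

theory Defs
  imports "HOL-Analysis.Analysis" "Jordan_Normal_Form.Matrix"
begin

text \<open>
  A real finite-dimensional vector space with a given inner product is a type of class
  \<^class>\<open>euclidean_space\<close>, the inner product being \<^const>\<open>inner\<close>.  A Lie bracket on it
  is an explicit function \<open>br\<close>.  Notions that also have to be applied to other inner products
  on the same space take the form \<open>g\<close> as an argument.
\<close>

section \<open>Lie algebras\<close>

definition lie_bracket :: "('g::real_vector \<Rightarrow> 'g \<Rightarrow> 'g) \<Rightarrow> bool" where
  "lie_bracket br \<longleftrightarrow>
     bilinear br \<and> (\<forall>x. br x x = 0) \<and>
     (\<forall>x y z. br x (br y z) + br y (br z x) + br z (br x y) = 0)"

definition bracket_span :: "('g::real_vector \<Rightarrow> 'g \<Rightarrow> 'g) \<Rightarrow> 'g set \<Rightarrow> 'g set \<Rightarrow> 'g set" where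
  "bracket_span br S T = span {br x y | x y. x \<in> S \<and> y \<in> T}"

primrec derived_series :: "('g::real_vector \<Rightarrow> 'g \<Rightarrow> 'g) \<Rightarrow> nat \<Rightarrow> 'g set" where
  "derived_series br 0 = UNIV"
| "derived_series br (Suc k) = bracket_span br (derived_series br k) (derived_series br k)"

definition lie_solvable :: "('g::real_vector \<Rightarrow> 'g \<Rightarrow> 'g) \<Rightarrow> bool" where
  "lie_solvable br \<longleftrightarrow> (\<exists>k. derived_series br k = {0})"

primrec lower_central_series ::
    "('g::real_vector \<Rightarrow> 'g \<Rightarrow> 'g) \<Rightarrow> 'g set \<Rightarrow> nat \<Rightarrow> 'g set" where
  "lower_central_series br I 0 = I"
| "lower_central_series br I (Suc k) = bracket_span br I (lower_central_series br I k)"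

definition lie_ideal :: "('g::real_vector \<Rightarrow> 'g \<Rightarrow> 'g) \<Rightarrow> 'g set \<Rightarrow> bool" where
  "lie_ideal br I \<longleftrightarrow> subspace I \<and> (\<forall>x. \<forall>y\<in>I. br x y \<in> I)"

definition nilpotent_ideal :: "('g::real_vector \<Rightarrow> 'g \<Rightarrow> 'g) \<Rightarrow> 'g set \<Rightarrow> bool" where
  "nilpotent_ideal br I \<longleftrightarrow> lie_ideal br I \<and> (\<exists>k. lower_central_series br I k = {0})"

text \<open>The maximal nilpotent ideal, i.e. the greatest one with respect to inclusion.\<close>

definition is_nilradical :: "('g::real_vector \<Rightarrow> 'g \<Rightarrow> 'g) \<Rightarrow> 'g set \<Rightarrow> bool" where
  "is_nilradical br H \<longleftrightarrow> nilpotent_ideal br H \<and> (\<forall>I. nilpotent_ideal br I \<longrightarrow> I \<subseteq> H)"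

definition lie_center :: "('g::real_vector \<Rightarrow> 'g \<Rightarrow> 'g) \<Rightarrow> 'g set" where
  "lie_center br = {z. \<forall>x. br z x = 0}"


section \<open>Endomorphisms of a subspace\<close>

text \<open>An endomorphism of a subspace \<open>H\<close> is a function on the whole type of which only the values
  on \<open>H\<close> matter.\<close>

definition endomorphism_on :: "'g::real_vector set \<Rightarrow> ('g \<Rightarrow> 'g) \<Rightarrow> bool" where
  "endomorphism_on H T \<longleftrightarrow>
     T \<in> H \<rightarrow> H \<and> (\<forall>x\<in>H. \<forall>y\<in>H. T (x + y) = T x + T y) \<and> (\<forall>c. \<forall>x\<in>H. T (c *\<^sub>R x) = c *\<^sub>R T x)"

definition so_on :: "('g::real_vector \<Rightarrow> 'g \<Rightarrow> real) \<Rightarrow> 'g set \<Rightarrow> ('g \<Rightarrow> 'g) set" where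
  "so_on g H = {T. endomorphism_on H T \<and> (\<forall>x\<in>H. \<forall>y\<in>H. g (T x) y = - g x (T y))}"

definition commutator :: "('g::real_vector \<Rightarrow> 'g) \<Rightarrow> ('g \<Rightarrow> 'g) \<Rightarrow> 'g \<Rightarrow> 'g" where
  "commutator S T = (\<lambda>x. S (T x) - T (S x))"

definition orthonormal_basis ::
    "('g::real_vector \<Rightarrow> 'g \<Rightarrow> real) \<Rightarrow> 'g set \<Rightarrow> 'g list \<Rightarrow> bool" where
  "orthonormal_basis g S es \<longleftrightarrow>
     span (set es) = S \<and>
     (\<forall>i<length es. \<forall>j<length es. g (es ! i) (es ! j) = (if i = j then 1 else 0))"

text \<open>\<open>M\<close> is the matrix of \<open>T\<close> in the basis \<open>es\<close>; its columns are the coordinates of the images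
  of the basis vectors.\<close>

definition represented_by :: "('g::real_vector \<Rightarrow> 'g) \<Rightarrow> 'g list \<Rightarrow> real mat \<Rightarrow> bool" where
  "represented_by T es M \<longleftrightarrow>
     M \<in> carrier_mat (length es) (length es) \<and>
     (\<forall>j<length es. T (es ! j) = (\<Sum>i<length es. (M $$ (i, j)) *\<^sub>R (es ! i)))"


section \<open>Hermitian, SKT and Kaehler structures\<close>

definition inner_product :: "('g::real_vector \<Rightarrow> 'g \<Rightarrow> real) \<Rightarrow> bool" where
  "inner_product g \<longleftrightarrow>
     bilinear g \<and> (\<forall>x y. g x y = g y x) \<and> (\<forall>x. x \<noteq> 0 \<longrightarrow> g x x > 0)"

definition hermitian_inner_product ::
    "('g::real_vector \<Rightarrow> 'g) \<Rightarrow> ('g \<Rightarrow> 'g \<Rightarrow> real) \<Rightarrow> bool" where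
  "hermitian_inner_product J g \<longleftrightarrow> inner_product g \<and> (\<forall>x y. g (J x) (J y) = g x y)"

definition almost_hermitian :: "('g::real_vector \<Rightarrow> 'g) \<Rightarrow> ('g \<Rightarrow> 'g \<Rightarrow> real) \<Rightarrow> bool" where
  "almost_hermitian J g \<longleftrightarrow>
     linear J \<and> (\<forall>x. J (J x) = - x) \<and> hermitian_inner_product J g"

definition integrable_acs :: "('g::real_vector \<Rightarrow> 'g \<Rightarrow> 'g) \<Rightarrow> ('g \<Rightarrow> 'g) \<Rightarrow> bool" where
  "integrable_acs br J \<longleftrightarrow>
     (\<forall>x y. br x y + J (br (J x) y + br x (J y)) - br (J x) (J y) = 0)"

definition fundamental_form ::
    "('g::real_vector \<Rightarrow> 'g) \<Rightarrow> ('g \<Rightarrow> 'g \<Rightarrow> real) \<Rightarrow> 'g \<Rightarrow> 'g \<Rightarrow> real" where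
  "fundamental_form J g x y = g (J x) y"

text \<open>
  The Chevalley--Eilenberg differential of a \<open>p\<close>-form,
  \<open>(d \<alpha>)(x0,\<dots>,xp) = (\<Sum>i<j. (-1)^(i+j) * \<alpha>([xi,xj],x0,\<dots>,xp))\<close> with \<open>xi\<close> and \<open>xj\<close> omitted
  from the trailing arguments (so \<open>(d \<alpha>)(x,y) = - \<alpha>([x,y])\<close> on 1-forms), written out for \<open>p = 2\<close> and \<open>p = 3\<close>.
\<close>

definition ce_d2 ::
    "('g::real_vector \<Rightarrow> 'g \<Rightarrow> 'g) \<Rightarrow> ('g \<Rightarrow> 'g \<Rightarrow> real) \<Rightarrow> 'g \<Rightarrow> 'g \<Rightarrow> 'g \<Rightarrow> real" where
  "ce_d2 br \<alpha> x y z = - \<alpha> (br x y) z + \<alpha> (br x z) y - \<alpha> (br y z) x"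

definition ce_d3 ::
    "('g::real_vector \<Rightarrow> 'g \<Rightarrow> 'g) \<Rightarrow> ('g \<Rightarrow> 'g \<Rightarrow> 'g \<Rightarrow> real) \<Rightarrow> 'g \<Rightarrow> 'g \<Rightarrow> 'g \<Rightarrow> 'g \<Rightarrow> real"
    where
  "ce_d3 br \<alpha> w x y z =
     - \<alpha> (br w x) y z + \<alpha> (br w y) x z - \<alpha> (br w z) x y
     - \<alpha> (br x y) w z + \<alpha> (br x z) w y - \<alpha> (br y z) w x"

definition bismut_torsion ::
    "('g::real_vector \<Rightarrow> 'g \<Rightarrow> 'g) \<Rightarrow> ('g \<Rightarrow> 'g) \<Rightarrow> ('g \<Rightarrow> 'g \<Rightarrow> real) \<Rightarrow> 'g \<Rightarrow> 'g \<Rightarrow> 'g \<Rightarrow> real"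
    where
  "bismut_torsion br J g x y z = ce_d2 br (fundamental_form J g) (J x) (J y) (J z)"

definition skt :: "('g::real_vector \<Rightarrow> 'g \<Rightarrow> 'g) \<Rightarrow> ('g \<Rightarrow> 'g) \<Rightarrow> ('g \<Rightarrow> 'g \<Rightarrow> real) \<Rightarrow> bool" where
  "skt br J g \<longleftrightarrow>
     integrable_acs br J \<and> (\<forall>w x y z. ce_d3 br (bismut_torsion br J g) w x y z = 0)"

definition kaehler :: "('g::real_vector \<Rightarrow> 'g \<Rightarrow> 'g) \<Rightarrow> ('g \<Rightarrow> 'g) \<Rightarrow> ('g \<Rightarrow> 'g \<Rightarrow> real) \<Rightarrow> bool" where
  "kaehler br J g \<longleftrightarrow>
     integrable_acs br J \<and> (\<forall>x y z. ce_d2 br (fundamental_form J g) x y z = 0)"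

definition kaehler_metric ::
    "('g::real_vector \<Rightarrow> 'g \<Rightarrow> 'g) \<Rightarrow> ('g \<Rightarrow> 'g) \<Rightarrow> ('g \<Rightarrow> 'g \<Rightarrow> real) \<Rightarrow> bool" where
  "kaehler_metric br J g \<longleftrightarrow>
     hermitian_inner_product J g \<and> (\<forall>x y z. ce_d2 br (fundamental_form J g) x y z = 0)"

end

theory Submission
  imports Defs
begin

text \<open>
  Let \<open>P\<close> be the orthogonal projection onto the abelian ideal \<open>\<h>\<close>, and extend \<open>A\<close>, \<open>B\<close>
  by zero to the whole space. Put \<open>Z = [U, J U]\<close>. Everything rests on the formula
  \<open>[x, y] = u(x) A y + v(x) B y - u(y) A x - v(y) B x + (u \<and> v)(x, y) Z\<close>, where \<open>u\<close> and \<open>v\<close> are the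
  coordinates along \<open>U\<close> and \<open>J U\<close> (\<open>br_eq\<close>), and on \<open>Z \<in> \<h>\<close>, which gives \<open>[A, B] = 0\<close>.
  If \<open>Z\<close> were not in \<open>\<h>\<close>, then \<open>ad Z\<close> would be nilpotent on \<open>\<h>\<close> and \<open>\<h> + \<real> Z\<close> would be a
  nilpotent ideal larger than the nilradical (\<open>Z_in_nilradical\<close>).

  SKT implies (i). Split \<open>A\<close> and \<open>B\<close> into the parts \<open>A'\<close>, \<open>B'\<close> that commute and \<open>A''\<close>, \<open>B''\<close> that
  anticommute with \<open>J\<close>. The trace of the equation \<open>dc(U, J U, x, J x) = 0\<close> over \<open>\<h>\<close> states that
  \<open>\<bar>A' + A'\<^sup>T\<bar>\<^sup>2 + \<bar>A'' - A''\<^sup>T\<bar>\<^sup>2\<close> plus the same for \<open>B\<close> is zero. Integrability gives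
  \<open>B'' = - A'' J\<close>. The part of \<open>[A, B] = 0\<close> that commutes with \<open>J\<close> is then
  \<open>[A', B'] = 2 A''\<^sup>2 J\<close>, and taking the trace of its composition with \<open>J\<close> yields \<open>A'' = 0\<close>
  (\<open>skew_and_complex_of_torsion_equation\<close>).

  (i) implies SKT. If \<open>A\<close> and \<open>B\<close> are skew and commute with \<open>J\<close>, they disappear from the torsion,
  and \<open>c = - u \<and> v \<and> \<langle>Z, \<cdot>\<rangle>\<close> (\<open>torsion_unitary\<close>). This form is closed, as \<open>u\<close> and \<open>v\<close> vanish on
  brackets and \<open>\<h>\<close> is abelian. It is zero if and only if \<open>Z = 0\<close>, which is (iii).

  (i) is equivalent to (ii) by simultaneous diagonalisation of the commuting symmetric operators
  \<open>J A\<close> and \<open>J B\<close> (\<open>adapted_orthonormal_basis_exists\<close>).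

  For (iv), if no nonzero element of \<open>\<h>\<close> is central, then \<open>B - A J\<close> is injective on \<open>\<h>\<close>, so
  \<open>Z = B X - A J X\<close> for some \<open>X\<close> (\<open>shear_exists\<close>). Then \<open>U + X\<close> and \<open>J (U + X)\<close> commute, and the metric that
  makes them orthonormal and orthogonal to \<open>\<h>\<close> is Kaehler (\<open>kaehler_metric_sheared\<close>).
\<close>

section \<open>Traces of operators on a Euclidean space\<close>

definition op_trace :: "('g::euclidean_space \<Rightarrow> 'g) \<Rightarrow> real" where
  "op_trace S = (\<Sum>b\<in>Basis. inner (S b) b)"

lemma op_trace_comp:
  assumes S: "linear S"
  shows "op_trace (S \<circ> T) = (\<Sum>b\<in>Basis. \<Sum>c\<in>Basis. inner (T b) c * inner (S c) b)"
proof -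
  have "inner (S (T b)) b = (\<Sum>c\<in>Basis. inner (T b) c * inner (S c) b)" for b
  proof -
    have "S (T b) = S (\<Sum>c\<in>Basis. inner (T b) c *\<^sub>R c)"
      by (simp add: euclidean_representation)
    also have "\<dots> = (\<Sum>c\<in>Basis. inner (T b) c *\<^sub>R S c)"
      by (simp add: linear_sum[OF S] linear_cmul[OF S])
    finally show ?thesis by (simp add: inner_sum_left)
  qed
  then show ?thesis by (simp add: op_trace_def)
qed

lemma op_trace_commute:
  assumes "linear S" "linear T"
  shows "op_trace (S \<circ> T) = op_trace (T \<circ> S)"
  unfolding op_trace_comp[OF assms(1)] op_trace_comp[OF assms(2)]
  by (subst sum.swap) (simp add: mult.commute)

text \<open>
  With \<open>\<epsilon> = 1\<close> or \<open>\<epsilon> = -1\<close>, the quantity \<open>tr (S\<^sup>T S) + \<epsilon> tr (S\<^sup>2)\<close> is half the square of the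
  Hilbert--Schmidt norm of \<open>S\<^sup>T + \<epsilon> S\<close>: it is nonnegative, and its vanishing
  forces \<open>S\<close> to be skew or symmetric, respectively.
\<close>

lemma twice_trace_eq_sum_squares:
  assumes S: "linear S" and eps: "\<epsilon> * \<epsilon> = (1::real)"
  shows "2 * (\<Sum>b\<in>Basis. inner (S b) (S b) + \<epsilon> * inner (S (S b)) b) =
    (\<Sum>b\<in>Basis. \<Sum>c\<in>Basis. (inner (S b) c + \<epsilon> * inner (S c) b)\<^sup>2)"
proof -
  have n: "inner (S b) (S b) = (\<Sum>c\<in>Basis. (inner (S b) c)\<^sup>2)" for b
    by (subst euclidean_inner) (simp add: power2_eq_square)
  have t: "(\<Sum>b\<in>Basis. inner (S (S b)) b)
      = (\<Sum>b\<in>Basis. \<Sum>c\<in>Basis. inner (S b) c * inner (S c) b)"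
    using op_trace_comp[OF S, of S] by (simp add: op_trace_def)
  have "(\<Sum>b\<in>Basis. \<Sum>c\<in>Basis. (inner (S b) c + \<epsilon> * inner (S c) b)\<^sup>2)
      = (\<Sum>b\<in>Basis. \<Sum>c\<in>Basis. (inner (S b) c)\<^sup>2)
        + (\<Sum>b\<in>Basis. \<Sum>c\<in>Basis. (inner (S c) b)\<^sup>2)
        + 2 * \<epsilon> * (\<Sum>b\<in>Basis. \<Sum>c\<in>Basis. inner (S b) c * inner (S c) b)"
  proof -
    have "(inner (S b) c + \<epsilon> * inner (S c) b)\<^sup>2
       = (inner (S b) c)\<^sup>2 + (inner (S c) b)\<^sup>2 + 2 * \<epsilon> * (inner (S b) c * inner (S c) b)" for b c
    proof -
      have "(inner (S b) c + \<epsilon> * inner (S c) b)\<^sup>2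
       = (inner (S b) c)\<^sup>2 + (\<epsilon> * \<epsilon>) * (inner (S c) b)\<^sup>2 + 2 * \<epsilon> * (inner (S b) c * inner (S c) b)"
        by (simp add: power2_eq_square algebra_simps)
      then show ?thesis by (simp add: eps)
    qed
    then show ?thesis by (simp add: sum.distrib sum_distrib_left)
  qed
  moreover have "(\<Sum>b\<in>Basis. \<Sum>c\<in>Basis. (inner (S c) b)\<^sup>2)
      = (\<Sum>b\<in>Basis. \<Sum>c\<in>Basis. (inner (S b) c)\<^sup>2)"
    by (rule sum.swap)
  ultimately show ?thesis
    by (simp add: sum.distrib n t[symmetric] sum_distrib_left[symmetric])
qed

lemma trace_nonneg:
  assumes "linear S" "\<epsilon> * \<epsilon> = (1::real)"
  shows "0 \<le> (\<Sum>b\<in>Basis. inner (S b) (S b) + \<epsilon> * inner (S (S b)) b)"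
proof -
  have "0 \<le> (\<Sum>b\<in>Basis. \<Sum>c\<in>Basis. (inner (S b) c + \<epsilon> * inner (S c) b)\<^sup>2)"
    by (intro sum_nonneg) auto
  then show ?thesis using twice_trace_eq_sum_squares[OF assms] by linarith
qed

lemma symmetry_of_trace_eq_0:
  assumes S: "linear S" and eps: "\<epsilon> * \<epsilon> = (1::real)"
    and 0: "(\<Sum>b\<in>Basis. inner (S b) (S b) + \<epsilon> * inner (S (S b)) b) = 0"
  shows "inner (S x) y = - \<epsilon> * inner x (S y)"
proof -
  have "(\<Sum>b\<in>Basis. \<Sum>c\<in>Basis. (inner (S b) c + \<epsilon> * inner (S c) b)\<^sup>2) = 0"
    using twice_trace_eq_sum_squares[OF S eps] 0 by simp
  then have z: "inner (S b) c + \<epsilon> * inner (S c) b = 0" if "b \<in> Basis" "c \<in> Basis" for b c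
    using that by (simp add: sum_nonneg_eq_0_iff sum_nonneg)
  have "(\<lambda>x y. inner (S x) y) = (\<lambda>x y. - \<epsilon> * inner x (S y))"
  proof (rule bilinear_eq_stdbasis)
    show "bilinear (\<lambda>x y. inner (S x) y)" "bilinear (\<lambda>x y. - \<epsilon> * inner x (S y))"
      by (auto simp: bilinear_def linear_iff linear_add[OF S] linear_cmul[OF S] algebra_simps)
    show "inner (S i) j = - \<epsilon> * inner i (S j)" if "i \<in> Basis" "j \<in> Basis" for i j
      using z[OF that] by (simp add: inner_commute)
  qed
  then show ?thesis by metis
qed

lemma linear_eq_0_of_sum_inner_self:
  assumes S: "linear S" and 0: "(\<Sum>b\<in>Basis. inner (S b) (S b)) = 0"
  shows "S x = 0"
proof -
  have "S b = 0" if "b \<in> Basis" for b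
    using 0 that by (simp add: sum_nonneg_eq_0_iff)
  then show ?thesis
    using linear_eq_on[OF S linear_zero, of x Basis] by (simp add: span_Basis)
qed

section \<open>The torsion equation for commuting operators\<close>

locale orthogonal_complex_structure =
  fixes J :: "'g::euclidean_space \<Rightarrow> 'g"
  assumes linJ: "linear J"
    and JJ [simp]: "J (J x) = - x"
    and Jiso: "inner (J x) (J y) = inner x y"
begin

lemmas J_simps [simp] =
  linear_add[OF linJ] linear_diff[OF linJ] linear_cmul[OF linJ] linear_neg[OF linJ] linear_0[OF linJ]

lemma J_skew: "inner (J x) y = - inner x (J y)"
  using Jiso[of x "J y"] by simp

text \<open>
  Split \<open>A = A' + A''\<close> and \<open>B = B' + B''\<close> into the parts that commute and anticommute with
  \<open>J\<close>. The torsion equation at the pair \<open>x\<close>, \<open>J x\<close>, summed over an orthonormal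
  basis, says that a sum of four squares of norms vanishes, those of \<open>A'\<^sup>T + A'\<close>,
  \<open>A''\<^sup>T - A''\<close> and the same for \<open>B\<close>. Hence \<open>A'\<close>, \<open>B'\<close> are skew and \<open>A''\<close>, \<open>B''\<close> are symmetric.
  Integrability is \<open>B'' = - A'' J\<close>, so that the part of \<open>[A, B] = 0\<close> that commutes with \<open>J\<close> reads
  \<open>[A', B'] = 2 A''\<^sup>2 J\<close>. Composing with \<open>J\<close> and taking traces kills the left side, since \<open>J\<close>
  commutes with \<open>A'\<close> and \<open>B'\<close>, and leaves \<open>- 2 tr (A''\<^sup>T A'')\<close> on the right side.
\<close>

theorem skew_and_complex_of_torsion_equation:
  assumes A: "linear A" and B: "linear B"
    and AB: "\<And>x. A (B x) = B (A x)"
    and int: "\<And>x. B (J x) - J (B x) = A x + J (A (J x))"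
    and tors: "\<And>x y. - inner (A (J (A x))) y + inner (A (J y)) (A x)
        + inner (A (J (A y))) x - inner (A (J x)) (A y)
        - inner (B (J (B x))) y + inner (B (J y)) (B x)
        + inner (B (J (B y))) x - inner (B (J x)) (B y) = 0"
  shows "inner (A x) y = - inner x (A y) \<and> inner (B x) y = - inner x (B y) \<and>
    A (J x) = J (A x) \<and> B (J x) = J (B x)"
proof -
  define com where "com S x = (1/2) *\<^sub>R (S x - J (S (J x)))" for S :: "'g \<Rightarrow> 'g" and x
  define ant where "ant S x = (1/2) *\<^sub>R (S x + J (S (J x)))" for S :: "'g \<Rightarrow> 'g" and x
  have lin_com: "linear (com S)" and lin_ant: "linear (ant S)" if S: "linear S" for S
    unfolding com_def ant_def
    by (auto simp: linear_iff linear_add[OF S] linear_cmul[OF S] algebra_simps)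
  have split: "S x = com S x + ant S x" for S x
    by (simp add: com_def ant_def algebra_simps flip: scaleR_add_left)
  have com_J: "com S (J x) = J (com S x)" if S: "linear S" for S x
    by (simp add: com_def linear_neg[OF S] algebra_simps)
  have ant_J: "ant S (J x) = - J (ant S x)" if S: "linear S" for S x
    by (simp add: ant_def linear_neg[OF S] algebra_simps)
  have point: "- inner (S (J (S x))) (J x) + inner (S (J (J x))) (S x)
        + inner (S (J (S (J x)))) x - inner (S (J x)) (S (J x)) =
      - 2 * (inner (com S x) (com S x) + 1 * inner (com S (com S x)) x
           + (inner (ant S x) (ant S x) + (-1) * inner (ant S (ant S x)) x))"
    if S: "linear S" for S x
  proof -
    note l = linear_add[OF lin_com[OF S]] linear_neg[OF lin_com[OF S]] linear_diff[OF lin_com[OF S]]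
      linear_add[OF lin_ant[OF S]] linear_neg[OF lin_ant[OF S]] linear_diff[OF lin_ant[OF S]]
      com_J[OF S] ant_J[OF S]
    have 1: "S (J (S x)) =
        J (com S (com S x) + com S (ant S x) - ant S (com S x) - ant S (ant S x))"
      by (simp add: split[of S] l)
    have 2: "S (J (J x)) = - (com S x + ant S x)"
      by (simp add: split[of S] l)
    have 3: "S (J x) = J (com S x - ant S x)"
      by (simp add: split[of S] l)
    have 4: "S (J (S (J x))) =
        com S (ant S x) - com S (com S x) - ant S (com S x) + ant S (ant S x)"
      unfolding 3 by (simp add: split[of S] l)
    show ?thesis
      unfolding 4 unfolding 1 2 3 Jiso unfolding split[of S x]
      by (simp add: inner_add_left inner_add_right inner_diff_left inner_diff_right inner_commute)
  qed
  let ?q = "\<lambda>\<epsilon> S. \<Sum>b\<in>Basis. inner (S b) (S b) + \<epsilon> * inner (S (S b)) b"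
  have "?q 1 (com A) + ?q (-1) (ant A) + (?q 1 (com B) + ?q (-1) (ant B)) = 0"
  proof -
    have "inner (com A x) (com A x) + 1 * inner (com A (com A x)) x
           + (inner (ant A x) (ant A x) + (-1) * inner (ant A (ant A x)) x)
         + (inner (com B x) (com B x) + 1 * inner (com B (com B x)) x
           + (inner (ant B x) (ant B x) + (-1) * inner (ant B (ant B x)) x)) = 0" for x
    proof -
      have "- 2 * (inner (com A x) (com A x) + 1 * inner (com A (com A x)) x
           + (inner (ant A x) (ant A x) + (-1) * inner (ant A (ant A x)) x))
         + - 2 * (inner (com B x) (com B x) + 1 * inner (com B (com B x)) x
           + (inner (ant B x) (ant B x) + (-1) * inner (ant B (ant B x)) x)) = 0"
        unfolding point[OF A, symmetric] point[OF B, symmetric]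
        using tors[of x "J x"] by (simp only: diff_conv_add_uminus add.assoc)
      then show ?thesis by (simp only: distrib_left[symmetric]) simp
    qed
    then show ?thesis
      unfolding sum.distrib[symmetric] by simp
  qed
  moreover have "0 \<le> ?q 1 (com A)" "0 \<le> ?q (-1) (ant A)" "0 \<le> ?q 1 (com B)" "0 \<le> ?q (-1) (ant B)"
    by (intro trace_nonneg lin_com lin_ant A B; simp)+
  ultimately have q0: "?q 1 (com A) = 0" "?q (-1) (ant A) = 0" "?q 1 (com B) = 0"
    by linarith+
  have skA: "inner (com A x) y = - inner x (com A y)" for x y
    using symmetry_of_trace_eq_0[OF lin_com[OF A] _ q0(1)] by simp
  have skB: "inner (com B x) y = - inner x (com B y)" for x y
    using symmetry_of_trace_eq_0[OF lin_com[OF B] _ q0(3)] by simp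
  have syA: "inner (ant A x) y = inner x (ant A y)" for x y
    using symmetry_of_trace_eq_0[OF lin_ant[OF A] _ q0(2)] by simp
  have antB: "ant B x = J (ant A x)" for x
  proof -
    have "B x + J (B (J x)) = J (A x + J (A (J x)))"
      using arg_cong[OF int[of x], of J] by (simp add: algebra_simps)
    then show ?thesis unfolding ant_def by (simp only: J_simps)
  qed
  have comm: "com A (com B x) - com B (com A x) = 2 *\<^sub>R J (ant A (ant A x))" for x
  proof -
    have 1: "A (B x) - J (A (B (J x))) = B (A x) - J (B (A (J x)))"
      by (simp only: AB)
    have sum4: "S (T x) - J (S (T (J x))) = 2 *\<^sub>R (com S (com T x) + ant S (ant T x))"
      if S: "linear S" and T: "linear T" for S T
    proof -
      note l = linear_add[OF lin_com[OF S]] linear_diff[OF lin_com[OF S]]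
        linear_add[OF lin_ant[OF S]] linear_diff[OF lin_ant[OF S]]
        com_J[OF S] ant_J[OF S] com_J[OF T] ant_J[OF T]
      show ?thesis
        by (simp add: split[of S] split[of T] l scaleR_2)
    qed
    have "2 *\<^sub>R (com A (com B x) + ant A (ant B x)) = 2 *\<^sub>R (com B (com A x) + ant B (ant A x))"
      using 1 unfolding sum4[OF A B] sum4[OF B A] .
    then have "com A (com B x) + ant A (ant B x) = com B (com A x) + ant B (ant A x)"
      by simp
    then show ?thesis
      by (simp add: antB ant_J[OF A] scaleR_2 algebra_simps)
  qed
  have "(\<Sum>b\<in>Basis. inner (com A (com B (J b))) b) - (\<Sum>b\<in>Basis. inner (com B (com A (J b))) b)
      = - 2 * (\<Sum>b\<in>Basis. inner (ant A b) (ant A b))"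
  proof -
    have "inner (com A (com B (J b))) b - inner (com B (com A (J b))) b
        = - 2 * inner (ant A b) (ant A b)" for b
      using arg_cong[OF comm[of "J b"], of "\<lambda>v. inner v b"] syA[of "ant A b" b]
      by (simp add: inner_diff_left ant_J[OF A] linear_neg[OF lin_ant[OF A]])
    then show ?thesis
      by (simp add: sum_subtractf[symmetric] sum_distrib_left)
  qed
  moreover have "(\<Sum>b\<in>Basis. inner (com A (com B (J b))) b) = (\<Sum>b\<in>Basis. inner (com B (com A (J b))) b)"
    using op_trace_commute[OF lin_com[OF A] linear_compose[OF linJ lin_com[OF B]]]
    by (simp add: op_trace_def com_J[OF A])
  ultimately have "(\<Sum>b\<in>Basis. inner (ant A b) (ant A b)) = 0"
    by linarith
  then have antA0: "ant A x = 0" for x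
    by (rule linear_eq_0_of_sum_inner_self[OF lin_ant[OF A]])
  have "com A = A" "com B = B"
    by (rule ext, simp add: split[of A] split[of B] antA0 antB)+
  then show ?thesis
    using skA skB com_J[OF A] com_J[OF B] by simp
qed

end

section \<open>Orthonormal bases adapted to commuting symmetric operators\<close>

text \<open>
  The Rayleigh quotient attains its maximum \<open>\<mu>\<close> on the compact unit sphere of \<open>W\<close>. At a
  maximum point \<open>e\<close> the form \<open>\<mu> \<langle>x, x\<rangle> - \<langle>S x, x\<rangle>\<close>, which is nonnegative on \<open>W\<close>, vanishes; moving
  from \<open>e\<close> a little in the direction \<open>S e - \<mu> e\<close> would make it negative unless that direction
  is zero.
\<close>

lemma symmetric_operator_has_eigenvector:
  fixes S :: "'g::euclidean_space \<Rightarrow> 'g"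
  assumes S: "linear S" and W: "subspace W" and W0: "W \<noteq> {0}"
    and SW: "\<And>x. x \<in> W \<Longrightarrow> S x \<in> W"
    and sym: "\<And>x y. inner (S x) y = inner x (S y)"
  obtains e \<mu> where "e \<in> W" "inner e e = 1" "S e = \<mu> *\<^sub>R e"
proof -
  let ?K = "sphere 0 1 \<inter> W"
  obtain w where w: "w \<in> W" "w \<noteq> 0"
    using W0 subspace_0[OF W] by blast
  have "w /\<^sub>R norm w \<in> ?K"
    using w by (simp add: subspace_scale[OF W])
  then have ne: "?K \<noteq> {}" by blast
  have K: "compact ?K"
    by (intro compact_Int_closed closed_subspace W) simp
  have cont: "continuous_on ?K (\<lambda>x. inner (S x) x)"
    by (intro continuous_intros linear_continuous_on linear_conv_bounded_linear[THEN iffD1] S)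
  obtain e where e: "e \<in> ?K" and max: "\<And>x. x \<in> ?K \<Longrightarrow> inner (S x) x \<le> inner (S e) e"
    using continuous_attains_sup[OF K ne cont] by blast
  define \<mu> where "\<mu> = inner (S e) e"
  have e1: "inner e e = 1" and eW: "e \<in> W"
    using e by (simp_all add: dot_square_norm)
  have pos: "inner (S x) x \<le> \<mu> * inner x x" if x: "x \<in> W" for x
  proof (cases "x = 0")
    case True then show ?thesis by (simp add: linear_0[OF S])
  next
    case False
    then have "x /\<^sub>R norm x \<in> ?K" using x by (simp add: subspace_scale[OF W])
    from max[OF this] have "inner (S x) x / (norm x * norm x) \<le> \<mu>"
      by (simp add: \<mu>_def linear_cmul[OF S] divide_inverse mult_ac)
    then show ?thesis using False
      by (simp add: dot_square_norm power2_eq_square field_simps)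
  qed
  define r where "r = S e - \<mu> *\<^sub>R e"
  have rW: "r \<in> W"
    unfolding r_def by (intro subspace_diff subspace_scale W SW eW)
  define q where "q = \<mu> * inner r r - inner (S r) r"
  have q: "0 \<le> q" using pos[OF rW] by (simp add: q_def)
  have quad: "2 * t * inner r r \<le> t * t * q" for t :: real
  proof -
    have "e + t *\<^sub>R r \<in> W" by (intro subspace_add subspace_scale W eW rW)
    from pos[OF this] have "inner (S e) e + t * inner (S e) r + t * inner (S r) e
        + t * t * inner (S r) r \<le> \<mu> * (inner e e + 2 * t * inner e r + t * t * inner r r)"
      by (simp add: linear_add[OF S] linear_cmul[OF S] algebra_simps inner_commute)
    moreover have "inner (S r) e = inner (S e) r"
      using sym[of r e] by (simp add: inner_commute)
    moreover have "inner (S e) r = inner r r + \<mu> * inner e r"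
      by (simp add: r_def inner_diff_left)
    ultimately show ?thesis
      by (simp add: e1 \<mu>_def[symmetric] q_def algebra_simps)
  qed
  have "r = 0"
  proof (rule ccontr)
    assume "r \<noteq> 0"
    then have p: "0 < inner r r" by simp
    \<comment> \<open>Small enough for the linear term in \<open>t\<close> to dominate the quadratic one.\<close>
    define t where "t = inner r r / (q + 1)"
    have t: "0 < t" using p q by (simp add: t_def)
    have "2 * inner r r \<le> t * q" using quad[of t] t by simp
    also have "\<dots> \<le> t * (q + 1)" using t by simp
    also have "\<dots> = inner r r" using q by (simp add: t_def)
    finally show False using p by simp
  qed
  then have "S e = \<mu> *\<^sub>R e" by (simp add: r_def)
  then show ?thesis using that eW e1 by blast
qed

text \<open>\<open>T\<close> preserves the eigenspaces of \<open>S\<close>.\<close>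

lemma commuting_symmetric_operators_have_common_eigenvector:
  fixes S T :: "'g::euclidean_space \<Rightarrow> 'g"
  assumes S: "linear S" and T: "linear T" and W: "subspace W" and W0: "W \<noteq> {0}"
    and SW: "\<And>x. x \<in> W \<Longrightarrow> S x \<in> W" and TW: "\<And>x. x \<in> W \<Longrightarrow> T x \<in> W"
    and symS: "\<And>x y. inner (S x) y = inner x (S y)"
    and symT: "\<And>x y. inner (T x) y = inner x (T y)"
    and ST: "\<And>x. S (T x) = T (S x)"
  obtains e \<mu> \<nu> where "e \<in> W" "inner e e = 1" "S e = \<mu> *\<^sub>R e" "T e = \<nu> *\<^sub>R e"
proof -
  obtain e0 \<mu> where e0: "e0 \<in> W" "inner e0 e0 = 1" "S e0 = \<mu> *\<^sub>R e0"
    by (rule symmetric_operator_has_eigenvector[OF S W W0 SW symS])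
  let ?E = "{x \<in> W. S x = \<mu> *\<^sub>R x}"
  have "subspace ?E"
    using W by (simp add: subspace_def linear_add[OF S] linear_cmul[OF S] linear_0[OF S]
        scaleR_add_right mult.commute)
  moreover have "?E \<noteq> {0}"
  proof -
    have "e0 \<noteq> 0" using e0(2) by auto
    moreover have "e0 \<in> ?E" using e0 by simp
    ultimately show ?thesis by blast
  qed
  moreover have "T x \<in> ?E" if "x \<in> ?E" for x
    using that TW[of x] ST[of x] by (simp add: linear_cmul[OF T])
  ultimately obtain e \<nu> where "e \<in> ?E" "inner e e = 1" "T e = \<nu> *\<^sub>R e"
    by (rule symmetric_operator_has_eigenvector[OF T _ _ _ symT])
  then show ?thesis using that by blast
qed

lemma orthonormal_basis_Nil: "orthonormal_basis g {0} []"
  by (simp add: orthonormal_basis_def)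

lemma orthonormal_basis_Cons:
  fixes e :: "'g::euclidean_space"
  assumes es: "orthonormal_basis inner W es" and e: "inner e e = 1"
    and perp: "\<And>x. x \<in> W \<Longrightarrow> inner e x = 0"
  shows "orthonormal_basis inner (span (insert e W)) (e # es)"
proof -
  have sp: "span (set es) = W" using es by (simp add: orthonormal_basis_def)
  have "span (set (e # es)) = span (insert e W)"
    unfolding sp[symmetric] by (simp add: span_insert span_span)
  moreover have mem: "es ! i \<in> W" if "i < length es" for i
    using that sp by (metis nth_mem span_base)
  have "inner ((e # es) ! i) ((e # es) ! j) = (if i = j then 1 else 0)"
    if "i < Suc (length es)" "j < Suc (length es)" for i j
  proof -
    have "inner e (es ! k) = 0" "inner (es ! k) e = 0" if "k < length es" for k
      using perp[OF mem[OF that]] by (simp_all add: inner_commute)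
    then show ?thesis
      using that es e by (cases i; cases j) (simp_all add: orthonormal_basis_def)
  qed
  ultimately show ?thesis by (simp add: orthonormal_basis_def)
qed

lemma orthonormal_basis_length:
  fixes es :: "'g::euclidean_space list"
  assumes es: "orthonormal_basis inner W es"
  shows "length es = dim W"
proof -
  have on: "inner (es ! i) (es ! j) = (if i = j then 1 else 0)"
    if "i < length es" "j < length es" for i j
    using es that by (simp add: orthonormal_basis_def)
  have d: "distinct es"
    unfolding distinct_conv_nth
  proof (intro allI impI notI)
    fix i j assume "i < length es" "j < length es" "i \<noteq> j" "es ! i = es ! j"
    then show False using on[of i i] on[of i j] by simp
  qed
  have "pairwise Linear_Algebra.orthogonal (set es)"
    unfolding pairwise_def Linear_Algebra.orthogonal_def by (auto simp: in_set_conv_nth on)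
  moreover have "0 \<notin> set es"
    using on by (fastforce simp: in_set_conv_nth)
  ultimately have "independent (set es)"
    by (rule pairwise_orthogonal_independent)
  then have "dim (span (set es)) = card (set es)"
    by (rule dim_span_eq_card_independent)
  moreover have "span (set es) = W" using es by (simp add: orthonormal_basis_def)
  ultimately show ?thesis using distinct_card[OF d] by metis
qed

context orthogonal_complex_structure
begin

lemma inner_J_self [simp]: "inner (J x) x = 0"
  using J_skew[of x x] by (simp add: inner_commute)

text \<open>
  A common unit eigenvector \<open>e\<close> of \<open>S\<close> and \<open>T\<close> yields the orthonormal pair \<open>e\<close>, \<open>J e\<close> of
  eigenvectors; the orthogonal complement of this pair is again invariant.
\<close>

lemma adapted_orthonormal_basis_exists:
  assumes S: "linear S" and T: "linear T" and W: "subspace W"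
    and SW: "\<And>x. x \<in> W \<Longrightarrow> S x \<in> W" and TW: "\<And>x. x \<in> W \<Longrightarrow> T x \<in> W"
    and JW: "\<And>x. x \<in> W \<Longrightarrow> J x \<in> W"
    and symS: "\<And>x y. inner (S x) y = inner x (S y)"
    and symT: "\<And>x y. inner (T x) y = inner x (T y)"
    and ST: "\<And>x. S (T x) = T (S x)"
    and SJ: "\<And>x. S (J x) = J (S x)" and TJ: "\<And>x. T (J x) = J (T x)"
  shows "\<exists>m es a b. length es = 2 * m \<and> orthonormal_basis inner W es \<and>
    (\<forall>k<m. es ! (2 * k + 1) = J (es ! (2 * k)) \<and>
       S (es ! (2 * k)) = a k *\<^sub>R es ! (2 * k) \<and> T (es ! (2 * k)) = b k *\<^sub>R es ! (2 * k))"
  using W SW TW JW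
proof (induction "dim W" arbitrary: W rule: less_induct)
  case less
  show ?case
  proof (cases "W = {0}")
    case True
    then have "orthonormal_basis inner W []" by (simp add: orthonormal_basis_Nil)
    then show ?thesis by (intro exI[of _ 0] exI[of _ "[]"]) simp
  next
    case False
    obtain e \<mu> \<nu> where e: "e \<in> W" "inner e e = 1" "S e = \<mu> *\<^sub>R e" "T e = \<nu> *\<^sub>R e"
      by (rule commuting_symmetric_operators_have_common_eigenvector[OF S T less.prems(1) False
          less.prems(2,3) symS symT ST])
    define V where "V = {x \<in> W. inner e x = 0 \<and> inner (J e) x = 0}"
    have V: "subspace V"
      using less.prems(1) by (auto simp: V_def subspace_def inner_add_right)
    have "e \<notin> V" using e by (simp add: V_def)
    moreover have "V \<subseteq> W" by (auto simp: V_def)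
    ultimately have "V \<subset> W" using e(1) by blast
    then have "span V \<subset> span W"
      by (simp only: span_eq_iff[THEN iffD2, OF V] span_eq_iff[THEN iffD2, OF less.prems(1)])
    then have dim: "dim V < dim W"
      by (rule dim_psubset)
    have SV: "S x \<in> V" if "x \<in> V" for x
      using that symS[of e x] symS[of "J e" x] by (simp add: V_def less.prems e SJ)
    have TV: "T x \<in> V" if "x \<in> V" for x
      using that symT[of e x] symT[of "J e" x]
      by (simp add: V_def less.prems e TJ)
    have JV: "J x \<in> V" if "x \<in> V" for x
      using that J_skew[of e x] Jiso[of e x] by (simp add: V_def less.prems)
    obtain m es a b where es: "length es = 2 * m" "orthonormal_basis inner V es"
      and eig: "\<And>k. k < m \<Longrightarrow> es ! (2 * k + 1) = J (es ! (2 * k)) \<and>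
       S (es ! (2 * k)) = a k *\<^sub>R es ! (2 * k) \<and> T (es ! (2 * k)) = b k *\<^sub>R es ! (2 * k)"
      using less.hyps[OF dim V SV TV JV] by blast
    have 1: "orthonormal_basis inner (span (insert (J e) V)) (J e # es)"
      using e by (intro orthonormal_basis_Cons es) (auto simp: Jiso V_def)
    have perp: "inner e x = 0" if "x \<in> span (insert (J e) V)" for x
    proof -
      have "insert (J e) V \<subseteq> {x. inner e x = 0}"
        by (auto simp: V_def inner_commute[of e "J e"])
      moreover have "subspace {x. inner e x = 0}"
        by (auto simp: subspace_def inner_add_right)
      ultimately show ?thesis using that span_minimal by blast
    qed
    have 2: "orthonormal_basis inner (span (insert e (span (insert (J e) V)))) (e # J e # es)"
      using e by (intro orthonormal_basis_Cons 1 perp)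
    have "span (insert e (span (insert (J e) V))) = W"
    proof
      show "span (insert e (span (insert (J e) V))) \<subseteq> W"
      proof -
        have "span (insert (J e) V) \<subseteq> W"
          using e(1) less.prems(1,4) by (intro span_minimal) (auto simp: V_def)
        then show ?thesis
          using e(1) less.prems(1) by (intro span_minimal) simp_all
      qed
    next
      show "W \<subseteq> span (insert e (span (insert (J e) V)))" (is "_ \<subseteq> ?R")
      proof
        fix x assume x: "x \<in> W"
        let ?y = "x - inner e x *\<^sub>R e - inner (J e) x *\<^sub>R J e"
        have "?y \<in> V"
        proof -
          have "?y \<in> W"
            by (intro subspace_diff subspace_scale less.prems(1,4) e(1) x)
          then show ?thesis
            using e(2) by (simp add: V_def inner_diff_right Jiso inner_commute[of e "J e"])
        qed
        then have "?y \<in> ?R" "J e \<in> ?R" "e \<in> ?R"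
          by (simp_all add: span_base)
        then have "?y + inner e x *\<^sub>R e + inner (J e) x *\<^sub>R J e \<in> ?R"
          by (intro span_add span_scale)
        then show "x \<in> ?R" by simp
      qed
    qed
    with 2 have "orthonormal_basis inner W (e # J e # es)" by simp
    moreover have "\<forall>k<Suc m. (e # J e # es) ! (2 * k + 1) = J ((e # J e # es) ! (2 * k)) \<and>
       S ((e # J e # es) ! (2 * k)) = case_nat \<mu> a k *\<^sub>R (e # J e # es) ! (2 * k) \<and>
       T ((e # J e # es) ! (2 * k)) = case_nat \<nu> b k *\<^sub>R (e # J e # es) ! (2 * k)"
    proof (intro allI impI)
      fix k assume "k < Suc m"
      then show "(e # J e # es) ! (2 * k + 1) = J ((e # J e # es) ! (2 * k)) \<and>
       S ((e # J e # es) ! (2 * k)) = case_nat \<mu> a k *\<^sub>R (e # J e # es) ! (2 * k) \<and>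
       T ((e # J e # es) ! (2 * k)) = case_nat \<nu> b k *\<^sub>R (e # J e # es) ! (2 * k)"
        using eig e by (cases k) auto
    qed
    moreover have "length (e # J e # es) = 2 * Suc m" by (simp add: es)
    ultimately show ?thesis
      by (intro exI[of _ "Suc m"] exI[of _ "e # J e # es"] exI[of _ "case_nat \<mu> a"]
          exI[of _ "case_nat \<nu> b"] conjI)
  qed
qed

end

section \<open>Block diagonal matrices with blocks of size two\<close>

lemma diag_block_mat_carrier_2:
  assumes "\<forall>M\<in>set Ms. M \<in> carrier_mat 2 2"
  shows "diag_block_mat Ms \<in> carrier_mat (2 * length Ms) (2 * length Ms)"
  using assms by (induction Ms) (auto simp: Let_def)

lemma diag_block_mat_index_2:
  assumes "\<forall>M\<in>set Ms. M \<in> carrier_mat 2 2" "i < 2 * length Ms" "j < 2 * length Ms"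
  shows "diag_block_mat Ms $$ (i, j) =
    (if i div 2 = j div 2 then (Ms ! (i div 2)) $$ (i mod 2, j mod 2) else 0)"
  using assms
proof (induction Ms arbitrary: i j)
  case Nil
  then show ?case by simp
next
  case (Cons M Ms)
  then have M: "dim_row M = 2" "dim_col M = 2" by auto
  have "diag_block_mat Ms \<in> carrier_mat (2 * length Ms) (2 * length Ms)"
    using Cons.prems by (intro diag_block_mat_carrier_2) simp
  then have D: "dim_row (diag_block_mat Ms) = 2 * length Ms"
    "dim_col (diag_block_mat Ms) = 2 * length Ms"
    by auto
  have small: "k div 2 = 0 \<and> k mod 2 = k" if "k < 2" for k :: nat
    using that by simp
  have big: "k div 2 = Suc ((k - 2) div 2) \<and> k mod 2 = (k - 2) mod 2" if "\<not> k < 2" for k :: nat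
    using that by (simp add: le_div_geq le_mod_geq)
  show ?case
    using Cons.prems small[of i] small[of j] big[of i] big[of j]
      Cons.IH[of "i - 2" "j - 2"]
    by (simp add: Let_def M D)
qed

lemma sum_over_pair:
  fixes f :: "nat \<Rightarrow> 'a::comm_monoid_add"
  assumes "k < m"
  shows "(\<Sum>i<2 * m. if i div 2 = k then f i else 0) = f (2 * k) + f (2 * k + 1)"
proof -
  have "(\<Sum>i<2 * m. if i div 2 = k then f i else 0) = (\<Sum>i\<in>{2 * k, 2 * k + 1}. f i)"
    using assms by (intro sum.mono_neutral_cong_right) auto
  then show ?thesis by simp
qed

text \<open>The lists of blocks are indexed from \<open>1\<close> to \<open>n - 1\<close>, the pairs of basis vectors from \<open>0\<close> to
  \<open>n - 2\<close>; this is the source of the shift \<open>Suc k\<close>.\<close>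

lemma represented_by_offdiagonal_blocks:
  fixes es :: "'g::real_vector list"
  assumes len: "length es = 2 * (n - 1)"
  shows "represented_by T es
      (diag_block_mat (map (\<lambda>i. mat_of_rows_list 2 [[0, p i], [q i, 0]]) [1..<n])) \<longleftrightarrow>
    (\<forall>k<n - 1. T (es ! (2 * k)) = q (Suc k) *\<^sub>R es ! (2 * k + 1) \<and>
               T (es ! (2 * k + 1)) = p (Suc k) *\<^sub>R es ! (2 * k))"
proof -
  let ?Ms = "map (\<lambda>i. mat_of_rows_list 2 [[0, p i], [q i, 0]]) [1..<n]"
  let ?D = "diag_block_mat ?Ms"
  have Ms: "\<forall>M\<in>set ?Ms. M \<in> carrier_mat 2 2" and lMs: "length ?Ms = n - 1"
    by (auto simp: mat_of_rows_list_def)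
  have D: "?D \<in> carrier_mat (length es) (length es)"
    using diag_block_mat_carrier_2[OF Ms] by (simp only: lMs len)
  have col: "(\<Sum>i<length es. ?D $$ (i, j) *\<^sub>R es ! i) =
      (if even j then q (Suc (j div 2)) *\<^sub>R es ! (j + 1) else p (Suc (j div 2)) *\<^sub>R es ! (j - 1))"
    if j: "j < length es" for j
  proof -
    have k: "j div 2 < n - 1" using j len by simp
    then have u: "[Suc 0..<n] ! (j div 2) = Suc (j div 2)"
      by (subst nth_upt) simp_all
    let ?f = "\<lambda>i. (mat_of_rows_list 2 [[0, p (Suc (j div 2))], [q (Suc (j div 2)), 0]]
        $$ (i mod 2, j mod 2)) *\<^sub>R es ! i"
    have "(\<Sum>i<length es. ?D $$ (i, j) *\<^sub>R es ! i)
        = (\<Sum>i<2 * (n - 1). if i div 2 = j div 2 then ?f i else 0)"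
    proof (rule sum.cong)
      fix i assume "i \<in> {..<2 * (n - 1)}"
      then have "?D $$ (i, j) =
          (if i div 2 = j div 2 then (?Ms ! (i div 2)) $$ (i mod 2, j mod 2) else 0)"
        using j len by (intro diag_block_mat_index_2[OF Ms]) (simp_all only: lMs lessThan_iff)
      then show "?D $$ (i, j) *\<^sub>R es ! i = (if i div 2 = j div 2 then ?f i else 0)"
        using k by (simp add: u)
    qed (simp add: len)
    also have "\<dots> = ?f (2 * (j div 2)) + ?f (2 * (j div 2) + 1)"
      by (rule sum_over_pair[OF k])
    also have "\<dots> =
      (if even j then q (Suc (j div 2)) *\<^sub>R es ! (j + 1) else p (Suc (j div 2)) *\<^sub>R es ! (j - 1))"
    proof (cases "even j")
      case True
      moreover have "Suc j mod 2 = 1" using True by presburger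
      ultimately show ?thesis by (simp add: mat_of_rows_list_def)
    next
      case False
      then have "2 * (j div 2) = j - 1" "j mod 2 = 1" "(j - 1) mod 2 = 0" "Suc (j - 1) = j"
        by presburger+
      with False show ?thesis by (simp add: mat_of_rows_list_def)
    qed
    finally show ?thesis .
  qed
  have "represented_by T es ?D \<longleftrightarrow> (\<forall>j<length es. T (es ! j) =
      (if even j then q (Suc (j div 2)) *\<^sub>R es ! (j + 1) else p (Suc (j div 2)) *\<^sub>R es ! (j - 1)))"
    using D col by (simp add: represented_by_def)
  also have "\<dots> \<longleftrightarrow> (\<forall>k<n - 1. T (es ! (2 * k)) = q (Suc k) *\<^sub>R es ! (2 * k + 1) \<and>
               T (es ! (2 * k + 1)) = p (Suc k) *\<^sub>R es ! (2 * k))" (is "?L \<longleftrightarrow> ?R")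
  proof
    assume L: ?L
    show ?R
    proof (intro allI impI)
      fix k assume "k < n - 1"
      then show "T (es ! (2 * k)) = q (Suc k) *\<^sub>R es ! (2 * k + 1) \<and>
               T (es ! (2 * k + 1)) = p (Suc k) *\<^sub>R es ! (2 * k)"
        using L[rule_format, of "2 * k"] L[rule_format, of "2 * k + 1"] len by simp
    qed
  next
    assume R: ?R
    show ?L
    proof (intro allI impI)
      fix j assume "j < length es"
      then have k: "j div 2 < n - 1" using len by simp
      show "T (es ! j) = (if even j then q (Suc (j div 2)) *\<^sub>R es ! (j + 1)
          else p (Suc (j div 2)) *\<^sub>R es ! (j - 1))"
      proof (cases "even j")
        case True
        then show ?thesis using R[rule_format, OF k] by simp
      next
        case False
        then have "2 * (j div 2) = j - 1" "2 * (j div 2) + 1 = j" by presburger+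
        with False show ?thesis using R[rule_format, OF k] by simp
      qed
    qed
  qed
  finally show ?thesis .
qed

lemma list_member_of_pair:
  assumes len: "length es = 2 * (m::nat)" and "e \<in> set es"
  shows "\<exists>k<m. e = es ! (2 * k) \<or> e = es ! (2 * k + 1)"
proof -
  obtain i where i: "i < length es" "es ! i = e"
    using assms(2) in_set_conv_nth[of e es] by blast
  have "i div 2 < m" "i = 2 * (i div 2) \<or> i = 2 * (i div 2) + 1"
    using i(1) len by presburger+
  then show ?thesis using i(2) by (intro exI[of _ "i div 2"]) auto
qed

lemma skew_of_offdiagonal_blocks:
  fixes es :: "'g::euclidean_space list"
  assumes A: "linear A" and es: "orthonormal_basis inner W es" and len: "length es = 2 * m"
    and blocks: "\<And>k. k < m \<Longrightarrow> A (es ! (2 * k)) = - c k *\<^sub>R es ! (2 * k + 1)"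
      "\<And>k. k < m \<Longrightarrow> A (es ! (2 * k + 1)) = c k *\<^sub>R es ! (2 * k)"
    and x: "x \<in> W" and y: "y \<in> W"
  shows "inner (A x) y = - inner x (A y)"
proof -
  have on: "inner (es ! i) (es ! j) = (if i = j then 1 else 0)"
    if "i < 2 * m" "j < 2 * m" for i j
    using es that len by (simp add: orthonormal_basis_def)
  have parity: "Suc (2 * k) \<noteq> 2 * l" "2 * l \<noteq> Suc (2 * k)" for k l :: nat by presburger+
  show ?thesis
  proof (rule bilinear_eq[of "\<lambda>x y. inner (A x) y" "\<lambda>x y. - inner x (A y)" W "set es" W "set es"])
    show "bilinear (\<lambda>x y. inner (A x) y)" "bilinear (\<lambda>x y. - inner x (A y))"
      by (auto simp: bilinear_def linear_iff linear_add[OF A] linear_cmul[OF A] algebra_simps)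
    show "W \<subseteq> span (set es)" "W \<subseteq> span (set es)" using es by (simp_all add: orthonormal_basis_def)
    show "inner (A e) f = - inner e (A f)" if e: "e \<in> set es" and f: "f \<in> set es" for e f
    proof -
      obtain k l where k: "k < m" "e = es ! (2 * k) \<or> e = es ! (2 * k + 1)"
        and l: "l < m" "f = es ! (2 * l) \<or> f = es ! (2 * l + 1)"
        using list_member_of_pair[OF len e] list_member_of_pair[OF len f] by blast
      have "inner (es ! (2 * k)) (es ! (2 * l)) = (if k = l then 1 else 0)"
        "inner (es ! (2 * k + 1)) (es ! (2 * l + 1)) = (if k = l then 1 else 0)"
        "inner (es ! (2 * k)) (es ! (2 * l + 1)) = 0"
        "inner (es ! (2 * k + 1)) (es ! (2 * l)) = 0"
        using k(1) l(1) parity by (simp_all add: on)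
      then show ?thesis
        using k(2) l(2) blocks[OF k(1)] blocks[OF l(1)] by (elim disjE) simp_all
    qed
  qed (use x y in auto)
qed

context orthogonal_complex_structure
begin

lemma complex_of_offdiagonal_blocks:
  assumes A: "linear A" and es: "orthonormal_basis inner W es" and len: "length es = 2 * m"
    and J: "\<And>k. k < m \<Longrightarrow> J (es ! (2 * k)) = es ! (2 * k + 1)"
    and blocks: "\<And>k. k < m \<Longrightarrow> A (es ! (2 * k)) = - c k *\<^sub>R es ! (2 * k + 1)"
      "\<And>k. k < m \<Longrightarrow> A (es ! (2 * k + 1)) = c k *\<^sub>R es ! (2 * k)"
    and x: "x \<in> W"
  shows "A (J x) = J (A x)"
proof -
  have "A (J e) = J (A e)" if e: "e \<in> set es" for e
  proof -
    obtain k where k: "k < m" "e = es ! (2 * k) \<or> e = es ! (2 * k + 1)"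
      using list_member_of_pair[OF len e] by blast
    have J': "J (es ! (2 * k + 1)) = - es ! (2 * k)"
      using arg_cong[OF J[OF k(1)], of J] by simp
    show ?thesis
      using k(2) by (elim disjE) (simp_all only: J[OF k(1)] J' blocks[OF k(1)] J_simps
          linear_neg[OF A] scaleR_minus_left scaleR_minus_right minus_minus)
  qed
  then show ?thesis
    using linear_eq_on[OF linear_compose[OF linJ A] linear_compose[OF A linJ], of x "set es"]
      x es by (simp add: orthonormal_basis_def)
qed

end

section \<open>Nilpotency of a commutator eigenvector\<close>

lemma linear_funpow:
  fixes N :: "'g::real_vector \<Rightarrow> 'g"
  assumes "linear N"
  shows "linear (N ^^ k)"
  using assms by (induction k) (simp_all add: linear_iff)

text \<open>
  From \<open>[D, N] = c N\<close> one gets \<open>[D, N\<^sup>k] = k c N\<^sup>k\<close>, so that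
  \<open>k \<bar>c\<bar> \<parallel>N\<^sup>k\<parallel> \<le> 2 \<parallel>D\<parallel> \<parallel>N\<^sup>k\<parallel>\<close> for the operator norm. For large \<open>k\<close> this is
  possible only if \<open>N\<^sup>k = 0\<close>.
\<close>

lemma nilpotent_if_commutator_eigenvector:
  fixes D N :: "'g::euclidean_space \<Rightarrow> 'g"
  assumes D: "linear D" and N: "linear N"
    and DN: "\<And>x. D (N x) - N (D x) = c *\<^sub>R N x" and c: "c \<noteq> 0"
  obtains k where "\<And>x. (N ^^ k) x = 0"
proof -
  note linN = linear_funpow[OF N]
  have bl: "bounded_linear D" "bounded_linear (N ^^ k)" for k
    using D linN by (simp_all add: linear_conv_bounded_linear)
  have DNk: "D ((N ^^ k) x) - (N ^^ k) (D x) = (real k * c) *\<^sub>R (N ^^ k) x" for k x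
  proof (induction k)
    case 0
    show ?case by simp
  next
    case (Suc k)
    have "D ((N ^^ Suc k) x) - (N ^^ Suc k) (D x)
        = (D (N ((N ^^ k) x)) - N (D ((N ^^ k) x))) + N (D ((N ^^ k) x) - (N ^^ k) (D x))"
      by (simp add: linear_diff[OF N])
    also have "\<dots> = c *\<^sub>R N ((N ^^ k) x) + (real k * c) *\<^sub>R N ((N ^^ k) x)"
      unfolding DN Suc by (simp add: linear_cmul[OF N])
    finally show ?case by (simp add: algebra_simps)
  qed
  obtain k :: nat where k: "2 * onorm D < real k * \<bar>c\<bar>"
    using c by (metis reals_Archimedean3 zero_less_abs_iff)
  have "real k * \<bar>c\<bar> * onorm (N ^^ k) = onorm (\<lambda>x. (real k * c) *\<^sub>R (N ^^ k) x)"
    using onorm_scaleR[OF bl(2), of "real k * c" k] by (simp add: abs_mult)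
  also have "\<dots> = onorm (\<lambda>x. (D \<circ> (N ^^ k)) x + - ((N ^^ k) \<circ> D) x)"
    unfolding DNk[symmetric] by simp
  also have "\<dots> \<le> onorm (D \<circ> (N ^^ k)) + onorm (\<lambda>x. - ((N ^^ k) \<circ> D) x)"
  proof (intro onorm_triangle bounded_linear_minus)
    show "bounded_linear (D \<circ> (N ^^ k))" "bounded_linear ((N ^^ k) \<circ> D)"
      using linear_compose[OF linN D] linear_compose[OF D linN]
      by (simp_all only: linear_conv_bounded_linear)
  qed
  also have "\<dots> \<le> onorm D * onorm (N ^^ k) + onorm (N ^^ k) * onorm D"
    using onorm_compose[OF bl(1) bl(2)[of k]] onorm_compose[OF bl(2)[of k] bl(1)]
    unfolding onorm_neg by linarith
  finally have "(real k * \<bar>c\<bar> - 2 * onorm D) * onorm (N ^^ k) \<le> 0"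
    by (simp add: algebra_simps)
  then have "onorm (N ^^ k) \<le> 0"
    using k by (simp add: mult_le_0_iff)
  then have "onorm (N ^^ k) = 0"
    using onorm_pos_le[OF bl(2)] by (simp add: antisym)
  then have "\<forall>x. (N ^^ k) x = 0"
    using onorm_eq_0[OF bl(2)] by simp
  then show ?thesis using that by blast
qed

section \<open>Almost Hermitian Lie algebras with an abelian ideal of codimension two\<close>

text \<open>
  The ideal \<open>H\<close> is complex and abelian, and \<open>U\<close>, \<open>J U\<close> is an orthonormal basis of its orthogonal
  complement.
\<close>

locale abelian_ideal_codim2 = orthogonal_complex_structure J
  for J :: "'g::euclidean_space \<Rightarrow> 'g" +
  fixes br :: "'g \<Rightarrow> 'g \<Rightarrow> 'g" and H :: "'g set" and U :: 'g
  assumes bilinear_br: "bilinear br"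
    and br_self [simp]: "br x x = 0"
    and jacobi: "br x (br y z) + br y (br z x) + br z (br x y) = 0"
    and subspace_H: "subspace H"
    and ideal_H: "y \<in> H \<Longrightarrow> br x y \<in> H"
    and abelian_H: "x \<in> H \<Longrightarrow> y \<in> H \<Longrightarrow> br x y = 0"
    and J_H: "x \<in> H \<Longrightarrow> J x \<in> H"
    and U_unit: "inner U U = 1"
    and U_perp: "x \<in> H \<Longrightarrow> inner x U = 0"
    and H_complement: "x - inner x U *\<^sub>R U - inner x (J U) *\<^sub>R J U \<in> H"
begin

lemmas br_simps =
  bilinear_ladd[OF bilinear_br] bilinear_radd[OF bilinear_br]
  bilinear_lsub[OF bilinear_br] bilinear_rsub[OF bilinear_br]
  bilinear_lmul[OF bilinear_br] bilinear_rmul[OF bilinear_br]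
  bilinear_lneg[OF bilinear_br] bilinear_rneg[OF bilinear_br]
  bilinear_lzero[OF bilinear_br] bilinear_rzero[OF bilinear_br]

lemma br_swap: "br x y = - br y x"
proof -
  have "br (x + y) (x + y) = br x x + br x y + (br y x + br y y)"
    by (simp only: bilinear_ladd[OF bilinear_br] bilinear_radd[OF bilinear_br] add_ac)
  then have "br x y + br y x = 0" by simp
  then show ?thesis by (simp add: eq_neg_iff_add_eq_0)
qed

definition u :: "'g \<Rightarrow> real" where "u x = inner x U"
definition v :: "'g \<Rightarrow> real" where "v x = inner x (J U)"

text \<open>The orthogonal projection onto \<open>H\<close>, and the operators \<open>ad U\<close> and \<open>ad (J U)\<close> on \<open>H\<close>,
  extended by zero to the complement so that they become linear maps of the whole space.\<close>

definition P :: "'g \<Rightarrow> 'g" where "P x = x - u x *\<^sub>R U - v x *\<^sub>R J U"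
definition A :: "'g \<Rightarrow> 'g" where "A x = br U (P x)"
definition B :: "'g \<Rightarrow> 'g" where "B x = br (J U) (P x)"
definition Z :: 'g where "Z = br U (J U)"

lemma u_v_simps [simp]:
  "u (x + y) = u x + u y" "u (x - y) = u x - u y" "u (- x) = - u x" "u (c *\<^sub>R x) = c * u x" "u 0 = 0"
  "v (x + y) = v x + v y" "v (x - y) = v x - v y" "v (- x) = - v x" "v (c *\<^sub>R x) = c * v x" "v 0 = 0"
  "u U = 1" "v U = 0" "u (J U) = 0" "v (J U) = 1" "u (J x) = - v x" "v (J x) = u x"
  by (simp_all add: u_def v_def inner_add_left inner_diff_left U_unit Jiso inner_commute[of U "J U"]
      J_skew[of x])

lemma H_zero [simp]: "x \<in> H \<Longrightarrow> u x = 0" "x \<in> H \<Longrightarrow> v x = 0"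
proof -
  assume x: "x \<in> H"
  then show u: "u x = 0" by (simp add: u_def U_perp)
  show "v x = 0" using U_perp[OF J_H[OF x]] J_skew[of x U] by (simp add: v_def)
qed

lemma P_H [simp]: "x \<in> H \<Longrightarrow> P x = x"
  by (simp add: P_def)

lemma P_in_H [simp]: "P x \<in> H"
  using H_complement by (simp add: P_def u_def v_def)

lemma inner_P_H: "h \<in> H \<Longrightarrow> inner h (P w) = inner h w" "h \<in> H \<Longrightarrow> inner (P w) h = inner w h"
  using H_zero[of h] by (simp_all add: P_def inner_diff_left inner_diff_right u_def v_def
      inner_commute[of _ h])

lemma P_J [simp]: "P (J x) = J (P x)"
  by (simp add: P_def)

lemma P_U [simp]: "P U = 0" "P (J U) = 0"
  by (simp_all add: P_def)

lemma linear_P: "linear P"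
  by (simp add: linear_iff P_def algebra_simps)

lemma linear_A: "linear A" and linear_B: "linear B"
  by (simp_all add: linear_iff A_def B_def linear_add[OF linear_P] linear_cmul[OF linear_P] br_simps)

lemmas AB_linear_simps =
  linear_add[OF linear_A] linear_diff[OF linear_A] linear_neg[OF linear_A] linear_cmul[OF linear_A]
  linear_0[OF linear_A]
  linear_add[OF linear_B] linear_diff[OF linear_B] linear_neg[OF linear_B] linear_cmul[OF linear_B]
  linear_0[OF linear_B]

lemma A_in_H [simp]: "A x \<in> H" and B_in_H [simp]: "B x \<in> H"
  by (simp_all add: A_def B_def ideal_H)

lemma A_P [simp]: "A (P x) = A x" and B_P [simp]: "B (P x) = B x"
  by (simp_all add: A_def B_def)

lemma decompose: "x = P x + u x *\<^sub>R U + v x *\<^sub>R J U"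
  by (simp add: P_def)

lemma br_eq:
  "br x y = u x *\<^sub>R A y + v x *\<^sub>R B y - u y *\<^sub>R A x - v y *\<^sub>R B x + (u x * v y - v x * u y) *\<^sub>R Z"
proof -
  have "br (P x) (P y) = 0" by (simp add: abelian_H)
  moreover have "br (P x) U = - A x" "br (P x) (J U) = - B x" "br (J U) U = - Z"
    by (simp_all add: A_def B_def Z_def br_swap[of _ U] br_swap[of "P x" "J U"])
  ultimately show ?thesis
    by (subst (1) decompose[of x], subst (1) decompose[of y])
      (simp add: br_simps A_def B_def Z_def algebra_simps)
qed

text \<open>The Jacobi identity for \<open>U\<close>, \<open>J U\<close> and \<open>P x\<close>.\<close>

lemma ad_Z_eq: "br Z (P x) = A (B x) - B (A x)"
proof -
  have "br U (br (J U) (P x)) + br (J U) (br (P x) U) + br (P x) (br U (J U)) = 0"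
    by (rule jacobi)
  then have "br U (B x) + br (J U) (- A x) - br Z (P x) = 0"
    by (simp add: A_def B_def Z_def br_swap[of "P x" U] br_swap[of "P x" "br U (J U)"])
  moreover have "br U (B x) = A (B x)" "br (J U) (A x) = B (A x)"
    by (simp_all add: A_def[of "B x"] B_def[of "A x"])
  ultimately show ?thesis by (simp add: br_simps algebra_simps)
qed

text \<open>
  Write \<open>Z = [U, J U] = h + a U + b J U\<close> with \<open>h \<in> H\<close>, and suppose \<open>Z \<notin> H\<close>. For
  \<open>D = ad (b U - a J U)\<close> and \<open>N = ad Z\<close> on \<open>H\<close> one has \<open>[D, N] = (a\<^sup>2 + b\<^sup>2) N\<close>, so \<open>N\<close> is
  nilpotent. Then \<open>H + \<real> Z\<close>, which contains all brackets, is a nilpotent ideal, and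
  maximality of \<open>H\<close> puts \<open>Z\<close> into \<open>H\<close>.
\<close>

lemma Z_in_nilradical:
  assumes "is_nilradical br H"
  shows "Z \<in> H"
proof (rule ccontr)
  assume notin: "Z \<notin> H"
  define N where "N x = br Z (P x)" for x
  define D where "D x = v Z *\<^sub>R A x - u Z *\<^sub>R B x" for x
  have N_eq: "N x = u Z *\<^sub>R A x + v Z *\<^sub>R B x" for x
    unfolding N_def br_eq[of Z "P x"] by simp
  have linN: "linear N"
    by (simp add: linear_iff N_eq AB_linear_simps algebra_simps)
  have linD: "linear D"
    by (simp add: linear_iff D_def AB_linear_simps algebra_simps)
  have "u Z \<noteq> 0 \<or> v Z \<noteq> 0"
  proof (rule ccontr)
    assume "\<not> (u Z \<noteq> 0 \<or> v Z \<noteq> 0)"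
    then have "P Z = Z" by (simp add: P_def)
    then show False using notin P_in_H[of Z] by simp
  qed
  then have c: "u Z * u Z + v Z * v Z \<noteq> 0"
    by (simp add: sum_squares_eq_zero_iff)
  have comm: "D (N x) - N (D x) = (u Z * u Z + v Z * v Z) *\<^sub>R N x" for x
  proof -
    have "D (N x) - N (D x) = (u Z * u Z + v Z * v Z) *\<^sub>R (A (B x) - B (A x))"
      unfolding N_eq D_def by (simp add: AB_linear_simps algebra_simps)
    then show ?thesis by (simp add: N_def ad_Z_eq)
  qed
  obtain k where k: "\<And>x. (N ^^ k) x = 0"
    using nilpotent_if_commutator_eigenvector[OF linD linN comm c] by blast
  define I where "I = {x. \<exists>s. x - s *\<^sub>R Z \<in> H}"
  have "subspace I"
  proof (unfold subspace_def, intro conjI ballI allI)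
    show "0 \<in> I" by (auto simp: I_def subspace_0[OF subspace_H] intro!: exI[of _ 0])
  next
    fix x y assume "x \<in> I" "y \<in> I"
    then obtain s t where "x - s *\<^sub>R Z \<in> H" "y - t *\<^sub>R Z \<in> H" by (auto simp: I_def)
    then have "(x - s *\<^sub>R Z) + (y - t *\<^sub>R Z) \<in> H" by (rule subspace_add[OF subspace_H])
    then have "(x + y) - (s + t) *\<^sub>R Z \<in> H" by (simp add: algebra_simps)
    then show "x + y \<in> I" by (auto simp: I_def)
  next
    fix c x assume "x \<in> I"
    then obtain s where "x - s *\<^sub>R Z \<in> H" by (auto simp: I_def)
    then have "c *\<^sub>R (x - s *\<^sub>R Z) \<in> H" by (rule subspace_scale[OF subspace_H])
    then have "c *\<^sub>R x - (c * s) *\<^sub>R Z \<in> H" by (simp add: algebra_simps)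
    then show "c *\<^sub>R x \<in> I" by (auto simp: I_def)
  qed
  moreover have "br x y \<in> I" for x y
  proof -
    have "br x y - (u x * v y - v x * u y) *\<^sub>R Z
        = u x *\<^sub>R A y + v x *\<^sub>R B y - u y *\<^sub>R A x - v y *\<^sub>R B x"
      by (subst br_eq) simp
    also have "\<dots> \<in> H"
      by (intro subspace_add subspace_diff subspace_scale subspace_H A_in_H B_in_H)
    finally show ?thesis by (auto simp: I_def)
  qed
  ultimately have ideal: "lie_ideal br I" by (simp add: lie_ideal_def)
  have NH: "N h \<in> H" "N h = br Z h" if "h \<in> H" for h
    using that by (simp_all add: N_def ideal_H)
  have NkH: "(N ^^ j) h \<in> H" if "h \<in> H" for j h
    using that by (induction j) (simp_all add: NH(1))
  note linNk = linear_funpow[OF linN]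
  have br_I: "\<exists>s. br x y = s *\<^sub>R N y" if x: "x \<in> I" and y: "y \<in> H" for x y
  proof -
    obtain s where s: "x - s *\<^sub>R Z \<in> H" using x by (auto simp: I_def)
    have "br x y = br (x - s *\<^sub>R Z) y + s *\<^sub>R br Z y" by (simp add: br_simps)
    then have "br x y = s *\<^sub>R N y" using abelian_H[OF s y] NH(2)[OF y] by simp
    then show ?thesis by blast
  qed
  have lcs: "lower_central_series br I (Suc j) \<subseteq> (N ^^ Suc j) ` H" for j
  proof (induction j)
    case 0
    have "br x y \<in> N ` H" if x: "x \<in> I" and y: "y \<in> I" for x y
    proof -
      obtain s t where s: "x - s *\<^sub>R Z \<in> H" and t: "y - t *\<^sub>R Z \<in> H"
        using x y by (auto simp: I_def)
      define x' where "x' = x - s *\<^sub>R Z"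
      define y' where "y' = y - t *\<^sub>R Z"
      have x': "x' \<in> H" "x = x' + s *\<^sub>R Z" and y': "y' \<in> H" "y = y' + t *\<^sub>R Z"
        using s t by (simp_all add: x'_def y'_def)
      define h where "h = s *\<^sub>R y' - t *\<^sub>R x'"
      have h: "h \<in> H"
        unfolding h_def by (intro subspace_diff subspace_scale subspace_H x'(1) y'(1))
      have "br x y = br x' y' + t *\<^sub>R br x' Z + s *\<^sub>R br Z y' + (s * t) *\<^sub>R br Z Z"
        unfolding x'(2) y'(2) by (simp add: br_simps algebra_simps)
      also have "\<dots> = br Z h"
        unfolding h_def abelian_H[OF x'(1) y'(1)] br_swap[of x' Z] by (simp add: br_simps)
      finally show ?thesis using NH(2)[OF h] imageI[OF h, of N] by simp
    qed
    moreover have "subspace (N ` H)" by (rule linear_subspace_image[OF linN subspace_H])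
    ultimately have "bracket_span br I I \<subseteq> N ` H"
      unfolding bracket_span_def by (intro span_minimal) auto
    then show ?case by simp
  next
    case (Suc j)
    have "br x y \<in> (N ^^ Suc (Suc j)) ` H"
      if x: "x \<in> I" and y: "y \<in> lower_central_series br I (Suc j)" for x y
    proof -
      obtain h where h: "h \<in> H" "y = (N ^^ Suc j) h" using Suc y by blast
      then have "y \<in> H" using NkH by blast
      then obtain s where "br x y = s *\<^sub>R N y" using br_I[OF x] by blast
      also have "\<dots> = (N ^^ Suc (Suc j)) (s *\<^sub>R h)"
        using linear_cmul[OF linNk[of "Suc (Suc j)"], of s h] h(2) by simp
      finally show ?thesis using subspace_scale[OF subspace_H h(1)] by blast
    qed
    moreover have "subspace ((N ^^ Suc (Suc j)) ` H)"
      by (rule linear_subspace_image[OF linNk subspace_H])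
    ultimately have "bracket_span br I (lower_central_series br I (Suc j)) \<subseteq> (N ^^ Suc (Suc j)) ` H"
      unfolding bracket_span_def by (intro span_minimal) auto
    then show ?case by simp
  qed
  have "(N ^^ Suc k) ` H \<subseteq> {0}"
    using k by (auto simp: linear_0[OF linN])
  then have "lower_central_series br I (Suc k) \<subseteq> {0}" using lcs[of k] by blast
  moreover have "0 \<in> lower_central_series br I (Suc k)"
    by (simp add: bracket_span_def span_zero)
  ultimately have "lower_central_series br I (Suc k) = {0}" by blast
  with ideal have "nilpotent_ideal br I" unfolding nilpotent_ideal_def by blast
  then have "I \<subseteq> H" using assms by (simp add: is_nilradical_def)
  moreover have "Z \<in> I"
    by (auto simp: I_def subspace_0[OF subspace_H] intro!: exI[of _ 1])
  ultimately show False using notin by blast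
qed

end

section \<open>The torsion form\<close>

context abelian_ideal_codim2
begin

abbreviation tor :: "'g \<Rightarrow> 'g \<Rightarrow> 'g \<Rightarrow> real" where
  "tor \<equiv> bismut_torsion br J inner"

lemma torsion_eq:
  "tor x y z = - inner (br (J x) (J y)) z + inner (br (J x) (J z)) y - inner (br (J y) (J z)) x"
  by (simp add: bismut_torsion_def ce_d2_def fundamental_form_def Jiso)

lemma torsion_swap: "tor y x z = - tor x y z"
  by (simp add: torsion_eq br_swap[of "J y" "J x"])

lemma torsion_J:
  "ce_d2 br (fundamental_form J inner) x y z = tor (- J x) (- J y) (- J z)"
  by (simp add: bismut_torsion_def)

lemma torsion_H: "x \<in> H \<Longrightarrow> y \<in> H \<Longrightarrow> z \<in> H \<Longrightarrow> tor x y z = 0"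
  by (simp add: torsion_eq abelian_H J_H)

lemma torsion_U_J_U:
  assumes "x \<in> H" "y \<in> H"
  shows "tor U x y = - inner (B (J x)) y + inner (B (J y)) x"
    and "tor (J U) x y = inner (A (J x)) y - inner (A (J y)) x"
  using assms by (simp_all add: torsion_eq abelian_H J_H A_def B_def br_simps)

text \<open>The operators lie in the unitary Lie algebra of \<open>H\<close>. Quantifying over the whole space is
  harmless, since \<open>A\<close> and \<open>B\<close> are zero on the complement of \<open>H\<close> and \<open>J\<close> preserves it.\<close>

definition unitary_action :: bool where
  "unitary_action \<longleftrightarrow>
     (\<forall>x y. inner (A x) y = - inner x (A y)) \<and> (\<forall>x y. inner (B x) y = - inner x (B y)) \<and>
     (\<forall>x. A (J x) = J (A x)) \<and> (\<forall>x. B (J x) = J (B x))"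

context
  assumes Z_H: "Z \<in> H"
begin

lemma br_in_H: "br x y \<in> H"
  by (subst br_eq) (intro subspace_add subspace_diff subspace_scale subspace_H A_in_H B_in_H Z_H)

lemma A_B_commute: "A (B x) = B (A x)"
  using ad_Z_eq[of x] abelian_H[OF Z_H P_in_H[of x]] by simp

text \<open>Integrability enters through the pair \<open>P x\<close>, \<open>U\<close> only, and closedness of the torsion through the
  quadruples \<open>U\<close>, \<open>J U\<close>, \<open>P x\<close>, \<open>P y\<close> only.\<close>

theorem skt_imp_unitary_action:
  assumes "skt br J inner"
  shows unitary_action
proof -
  have int: "B (J x) - J (B x) = A x + J (A (J x))" for x
  proof -
    have "br (P x) U + J (br (J (P x)) U + br (P x) (J U)) - br (J (P x)) (J U) = 0"
      using assms by (simp add: skt_def integrable_acs_def)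
    then show ?thesis
      by (simp add: br_eq J_H flip: P_J) (simp add: algebra_simps)
  qed
  have tors: "- inner (A (J (A x))) y + inner (A (J y)) (A x)
        + inner (A (J (A y))) x - inner (A (J x)) (A y)
        - inner (B (J (B x))) y + inner (B (J y)) (B x)
        + inner (B (J (B y))) x - inner (B (J x)) (B y) = 0" for x y
  proof -
    have "ce_d3 br tor U (J U) (P x) (P y) = 0"
      using assms by (simp add: skt_def)
    moreover have "br U (J U) = Z" "br U (P w) = A w" "br (J U) (P w) = B w" for w
      by (simp_all add: Z_def A_def B_def)
    moreover have "tor 0 a b = 0" for a b by (simp add: torsion_eq br_simps)
    ultimately have "tor (A x) (J U) (P y) - tor (A y) (J U) (P x) - tor (B x) U (P y)
        + tor (B y) U (P x) = 0"
      by (simp add: ce_d3_def abelian_H torsion_H Z_H)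
    then show ?thesis
      by (simp add: torsion_swap[of _ U] torsion_swap[of _ "J U"] torsion_U_J_U flip: P_J)
        (simp add: inner_P_H J_H inner_commute)
  qed
  show ?thesis
    unfolding unitary_action_def
    using skew_and_complex_of_torsion_equation[OF linear_A linear_B A_B_commute int tors] by blast
qed

context
  assumes unitary: unitary_action
begin

lemma skew_A: "inner (A x) y = - inner x (A y)" and skew_B: "inner (B x) y = - inner x (B y)"
  and A_J [simp]: "A (J x) = J (A x)" and B_J [simp]: "B (J x) = J (B x)"
  using unitary by (auto simp: unitary_action_def)

text \<open>The product of two commuting skew operators is symmetric.\<close>

lemma JA_sym: "inner (J (A x)) y = inner (J (A y)) x"
  and JB_sym: "inner (J (B x)) y = inner (J (B y)) x"
  using J_skew[of "A x" y] skew_A[of x "J y"] J_skew[of "B x" y] skew_B[of x "J y"]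
  by (simp_all add: inner_commute)

text \<open>This is \<open>c = - u \<and> v \<and> \<langle>Z, \<cdot>\<rangle>\<close>: the contributions of \<open>A\<close> and \<open>B\<close> cancel in pairs because
  \<open>J A\<close> and \<open>J B\<close> are symmetric.\<close>

lemma torsion_unitary:
  "tor x y z = - (u x * v y - v x * u y) * inner Z z + (u x * v z - v x * u z) * inner Z y
     - (u y * v z - v y * u z) * inner Z x"
  by (simp add: torsion_eq br_eq inner_add_left inner_diff_left algebra_simps JA_sym[of x y] JA_sym[of x z]
      JA_sym[of y z] JB_sym[of x y] JB_sym[of x z] JB_sym[of y z])

lemma integrable_unitary: "integrable_acs br J"
  by (simp add: integrable_acs_def br_eq algebra_simps)

text \<open>
  As \<open>u\<close> and \<open>v\<close> vanish on brackets, \<open>dc\<close> only involves \<open>(u \<and> v)(r, s) \<langle>Z, [p, q]\<rangle>\<close>. The terms with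
  \<open>A\<close> and \<open>B\<close> cancel since \<open>u \<and> v \<and> u = u \<and> v \<and> v = 0\<close>, and those with \<open>\<langle>Z, Z\<rangle>\<close> by the Pluecker
  relation.
\<close>

theorem skt_unitary: "skt br J inner"
proof -
  have "ce_d3 br tor w x y z = 0" for w x y z
  proof -
    have c_br: "tor (br p q) r s = - (u r * v s - v r * u s) * inner Z (br p q)" for p q r s
      by (simp add: torsion_unitary br_in_H algebra_simps)
    show ?thesis
      unfolding ce_d3_def c_br
      by (simp add: br_eq inner_add_right inner_diff_right algebra_simps)
  qed
  then show ?thesis by (simp add: skt_def integrable_unitary)
qed

lemma kaehler_iff_Z: "kaehler br J inner \<longleftrightarrow> Z = 0"
proof
  assume "kaehler br J inner"
  then have "tor U (J U) Z = 0" by (simp add: kaehler_def bismut_torsion_def)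
  then show "Z = 0" by (simp add: torsion_unitary Z_H)
next
  assume "Z = 0"
  then show "kaehler br J inner"
    by (simp add: kaehler_def integrable_unitary torsion_J torsion_unitary)
qed

text \<open>Fixes \<open>H\<close> and sends \<open>U + X\<close> to \<open>U\<close> and \<open>J (U + X)\<close> to \<open>J U\<close>, for \<open>X \<in> H\<close>.\<close>

definition shear :: "'g \<Rightarrow> 'g \<Rightarrow> 'g" where "shear X x = x - u x *\<^sub>R X - v x *\<^sub>R J X"

text \<open>
  Replacing \<open>U\<close> by \<open>U + X\<close> with \<open>X \<in> H\<close> leaves the operators on \<open>H\<close> as they are and adds
  \<open>A J X - B X\<close> to \<open>[U, J U]\<close>. The hypothesis on \<open>Z\<close> thus makes the new bracket vanish, so that
  the metric for which \<open>U + X\<close> and \<open>J (U + X)\<close> are orthonormal and orthogonal to \<open>H\<close> is Kaehler. This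
  metric is the pullback of the given one by the shear.
\<close>

lemma kaehler_metric_sheared:
  assumes X: "X \<in> H" and Z: "Z = B X - J (A X)"
  shows "kaehler_metric br J (\<lambda>x y. inner (shear X x) (shear X y))"
proof -
  have shear_J: "shear X (J x) = J (shear X x)" for x by (simp add: shear_def)
  have shear_add: "shear X (x + y) = shear X x + shear X y" and shear_scale: "shear X (r *\<^sub>R x) = r *\<^sub>R shear X x" for x y r
    by (simp_all add: shear_def algebra_simps)
  have bil: "bilinear (\<lambda>x y. inner (shear X x) (shear X y))"
    by (auto simp: bilinear_def linear_iff shear_add shear_scale inner_add_left inner_add_right)
  have pos: "shear X x \<noteq> 0" if "x \<noteq> 0" for x
  proof
    assume 0: "shear X x = 0"
    have "u (shear X x) = u x" "v (shear X x) = v x" using X J_H[OF X] by (simp_all add: shear_def)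
    then have "u x = 0" "v x = 0" using 0 by simp_all
    then show False using 0 that by (simp add: shear_def)
  qed
  have "hermitian_inner_product J (\<lambda>x y. inner (shear X x) (shear X y))"
    by (simp add: hermitian_inner_product_def inner_product_def bil pos shear_J Jiso inner_commute)
  moreover have "ce_d2 br (fundamental_form J (\<lambda>x y. inner (shear X x) (shear X y))) x y z = 0" for x y z
  proof -
    have shear_br: "shear X (J (br p q)) = J (br p q)" for p q
      using br_in_H[of p q] by (simp add: shear_def)
    have om: "fundamental_form J (\<lambda>x y. inner (shear X x) (shear X y)) (br p q) r =
      inner (J (br p q)) r - u r * inner (J (br p q)) X - v r * inner (br p q) X" for p q r
      unfolding fundamental_form_def shear_br
      by (simp add: shear_def inner_diff_right Jiso)
    have e1: "inner (J Z) r = inner (J (B r)) X - inner (A r) X" for r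
      unfolding Z using JB_sym[of X r] skew_A[of X r]
      by (simp add: inner_add_left inner_add_right inner_commute)
    have e2: "inner Z X = - inner (J (A X)) X"
      unfolding Z using skew_B[of X X] by (simp add: inner_diff_left inner_diff_right inner_commute)
    show ?thesis
      unfolding ce_d2_def om
      by (simp add: br_eq inner_add_left inner_diff_left algebra_simps JA_sym[of x y] JA_sym[of x z]
      JA_sym[of y z] JB_sym[of x y] JB_sym[of x z] JB_sym[of y z] e1 e2)
  qed
  ultimately show ?thesis by (simp add: kaehler_metric_def)
qed

text \<open>
  \<open>A J\<close> is symmetric, \<open>B\<close> is skew, and they commute, so \<open>B x\<close> is orthogonal to \<open>A J x\<close>.
  Hence \<open>B x = A J x\<close> only if both vanish, that is, if \<open>x\<close> is central.
\<close>

lemma shear_exists: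
  assumes center: "lie_center br \<inter> H = {0}"
  shows "\<exists>X\<in>H. Z = B X - J (A X)"
proof -
  define T where "T x = B x - J (A x)" for x
  have T: "linear T"
    by (simp add: linear_iff T_def AB_linear_simps algebra_simps)
  have ker: "x = 0" if x: "x \<in> H" and 0: "T x = 0" for x
  proof -
    have "inner (B x) (J (A x)) = - inner (J (A x)) (B x)"
      using skew_B[of x "J (A x)"] JA_sym[of x "B x"] by (simp add: A_B_commute inner_commute)
    then have o: "inner (B x) (J (A x)) = 0" by (simp add: inner_commute)
    then have "B x = 0" using 0 by (simp add: T_def)
    moreover from this have "J (J (A x)) = 0" using 0 by (simp add: T_def)
    ultimately have "A x = 0" "B x = 0" by simp_all
    then have "x \<in> lie_center br" using x by (simp add: lie_center_def br_eq[of x])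
    then show ?thesis using center x by blast
  qed
  have "T x \<in> H" for x
    unfolding T_def by (intro subspace_diff subspace_H B_in_H J_H A_in_H)
  then have sub: "T ` H \<subseteq> H" by blast
  have "inj_on T (span H)"
  proof (rule inj_onI)
    fix x y assume "x \<in> span H" "y \<in> span H" and eq: "T x = T y"
    then have "x - y \<in> H" using span_eq_iff[THEN iffD2, OF subspace_H] subspace_diff[OF subspace_H] by simp
    moreover have "T (x - y) = 0" using eq by (simp add: linear_diff[OF T])
    ultimately show "x = y" using ker[of "x - y"] by simp
  qed
  then have "dim (T ` H) = dim H" by (rule dim_image_eq[OF T])
  then have "T ` H = H"
    using subspace_dim_equal[OF linear_subspace_image[OF T subspace_H] subspace_H sub] by simp
  then have "Z \<in> T ` H" using Z_H by simp
  then show ?thesis by (auto simp: T_def)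
qed

end

end

end

section \<open>The two descriptions of the action\<close>

lemma span_pairE:
  assumes "w \<in> span {x, y}"
  obtains a b where "w = a *\<^sub>R x + b *\<^sub>R y"
proof -
  obtain a where "w - a *\<^sub>R x \<in> span {y}"
    using assms span_breakdown_eq[of w x "{y}"] by blast
  then obtain b where "w - a *\<^sub>R x = b *\<^sub>R y"
    by (auto simp: span_singleton)
  then have "w = a *\<^sub>R x + b *\<^sub>R y" by (simp add: algebra_simps)
  then show ?thesis by (rule that)
qed

context abelian_ideal_codim2
begin

lemma so_on_H_iff:
  assumes S: "linear S" and S_H: "\<And>x. S x \<in> H" and S_P: "\<And>x. S (P x) = S x"
    and R: "\<And>x. x \<in> H \<Longrightarrow> R x = S x"
  shows "R \<in> so_on inner H \<longleftrightarrow> (\<forall>x y. inner (S x) y = - inner x (S y))"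
proof -
  have "R \<in> so_on inner H \<longleftrightarrow> (\<forall>x\<in>H. \<forall>y\<in>H. inner (S x) y = - inner x (S y))"
    by (simp add: so_on_def endomorphism_on_def R S_H subspace_add[OF subspace_H]
        subspace_scale[OF subspace_H] linear_add[OF S] linear_cmul[OF S])
  also have "\<dots> \<longleftrightarrow> (\<forall>x y. inner (S x) y = - inner x (S y))"
  proof (intro iffI allI)
    fix x y
    assume "\<forall>x\<in>H. \<forall>y\<in>H. inner (S x) y = - inner x (S y)"
    then have "inner (S (P x)) (P y) = - inner (P x) (S (P y))" by simp
    then show "inner (S x) y = - inner x (S y)"
      by (simp add: S_P inner_P_H S_H)
  qed simp
  finally show ?thesis .
qed

lemma commutator_J_iff:
  assumes S_H: "\<And>x. S x \<in> H" and S_P: "\<And>x. S (P x) = S x"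
    and R: "\<And>x. x \<in> H \<Longrightarrow> R x = S x"
  shows "(\<forall>x\<in>H. commutator R (restrict J H) x = 0) \<longleftrightarrow> (\<forall>x. S (J x) = J (S x))"
proof -
  have "(\<forall>x\<in>H. commutator R (restrict J H) x = 0) \<longleftrightarrow> (\<forall>x\<in>H. S (J x) = J (S x))"
    by (simp add: commutator_def R J_H S_H)
  also have "\<dots> \<longleftrightarrow> (\<forall>x. S (J x) = J (S x))"
    using S_P P_J P_in_H by metis
  finally show ?thesis .
qed

lemma restrict_br_H: "x \<in> H \<Longrightarrow> restrict (br U) H x = A x" "x \<in> H \<Longrightarrow> restrict (br (J U)) H x = B x"
  by (simp_all add: A_def B_def)

lemma cond_i_iff_unitary_action:
  "restrict (br U) H \<in> so_on inner H \<and> restrict (br (J U)) H \<in> so_on inner H \<and>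
     (\<forall>x\<in>H. commutator (restrict (br U) H) (restrict J H) x = 0) \<and>
     (\<forall>x\<in>H. commutator (restrict (br (J U)) H) (restrict J H) x = 0) \<longleftrightarrow> unitary_action"
  using so_on_H_iff[OF linear_A A_in_H A_P restrict_br_H(1)]
    so_on_H_iff[OF linear_B B_in_H B_P restrict_br_H(2)]
    commutator_J_iff[where S = A, OF A_in_H A_P restrict_br_H(1)]
    commutator_J_iff[where S = B, OF B_in_H B_P restrict_br_H(2)]
  by (simp only: unitary_action_def)

lemma represented_by_offdiagonal_blocks_on_H:
  assumes len: "length es = 2 * (n - 1)" and es: "orthonormal_basis inner H es"
    and R: "\<And>x. x \<in> H \<Longrightarrow> R x = S x"
  shows "represented_by R es
      (diag_block_mat (map (\<lambda>i. mat_of_rows_list 2 [[0, p i], [q i, 0]]) [1..<n])) \<longleftrightarrow>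
    (\<forall>k<n - 1. S (es ! (2 * k)) = q (Suc k) *\<^sub>R es ! (2 * k + 1) \<and>
               S (es ! (2 * k + 1)) = p (Suc k) *\<^sub>R es ! (2 * k))"
proof -
  have "R (es ! i) = S (es ! i)" if "i < length es" for i
  proof (rule R)
    have "es ! i \<in> span (set es)" using that by (simp add: span_base)
    then show "es ! i \<in> H" using es by (simp add: orthonormal_basis_def)
  qed
  then have "R (es ! (2 * k)) = S (es ! (2 * k))" "R (es ! (2 * k + 1)) = S (es ! (2 * k + 1))"
    if "k < n - 1" for k
    using that len by simp_all
  then show ?thesis
    unfolding represented_by_offdiagonal_blocks[OF len] by (simp cong: imp_cong)
qed

lemma skew_complex_of_blocks:
  assumes S: "linear S" and S_H: "\<And>x. S x \<in> H" and S_P: "\<And>x. S (P x) = S x"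
    and es: "orthonormal_basis inner H es" and len: "length es = 2 * m"
    and J: "\<And>k. k < m \<Longrightarrow> J (es ! (2 * k)) = es ! (2 * k + 1)"
    and blocks: "\<And>k. k < m \<Longrightarrow> S (es ! (2 * k)) = - c k *\<^sub>R es ! (2 * k + 1)"
      "\<And>k. k < m \<Longrightarrow> S (es ! (2 * k + 1)) = c k *\<^sub>R es ! (2 * k)"
  shows "(\<forall>x y. inner (S x) y = - inner x (S y)) \<and> (\<forall>x. S (J x) = J (S x))"
proof (intro conjI allI)
  fix x y
  have "inner (S (P x)) (P y) = - inner (P x) (S (P y))"
    by (rule skew_of_offdiagonal_blocks[OF S es len blocks P_in_H P_in_H])
  then show "inner (S x) y = - inner x (S y)"
    by (simp add: S_P inner_P_H S_H)
next
  fix x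
  have "S (J (P x)) = J (S (P x))"
    by (rule complex_of_offdiagonal_blocks[OF S es len J blocks P_in_H])
  then show "S (J x) = J (S x)" by (metis S_P P_J)
qed

text \<open>
  For a common unit eigenvector \<open>e\<close> of \<open>J A\<close> and \<open>J B\<close> with eigenvalues \<open>\<alpha>\<close> and \<open>\<beta>\<close> one has
  \<open>A e = - \<alpha> J e\<close>, \<open>A J e = \<alpha> e\<close> and the same for \<open>B\<close> and \<open>\<beta>\<close>, which are the prescribed blocks.
\<close>

lemma cond_ii_iff_unitary_action:
  assumes Z_H: "Z \<in> H" and dim: "dim H = 2 * (n - 1)"
  shows "(\<exists>es. length es = 2 * n - 2 \<and> orthonormal_basis inner H es \<and>
      (\<exists>a b :: nat \<Rightarrow> real.
        represented_by (restrict J H) es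
          (diag_block_mat (map (\<lambda>i. mat_of_rows_list 2 [[0, -1], [1, 0]]) [1..<n])) \<and>
        represented_by (restrict (br U) H) es
          (diag_block_mat (map (\<lambda>i. mat_of_rows_list 2 [[0, a i], [- a i, 0]]) [1..<n])) \<and>
        represented_by (restrict (br (J U)) H) es
          (diag_block_mat (map (\<lambda>i. mat_of_rows_list 2 [[0, b i], [- b i, 0]]) [1..<n]))))
    \<longleftrightarrow> unitary_action" (is "?L \<longleftrightarrow> _")
proof -
  have n2: "2 * n - 2 = 2 * (n - 1)" by simp
  have "?L \<longleftrightarrow> (\<exists>es. length es = 2 * (n - 1) \<and> orthonormal_basis inner H es \<and>
      (\<exists>a b. \<forall>k<n - 1.
        (J (es ! (2 * k)) = es ! (2 * k + 1) \<and> J (es ! (2 * k + 1)) = - es ! (2 * k)) \<and>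
        (A (es ! (2 * k)) = - a (Suc k) *\<^sub>R es ! (2 * k + 1) \<and>
          A (es ! (2 * k + 1)) = a (Suc k) *\<^sub>R es ! (2 * k)) \<and>
        (B (es ! (2 * k)) = - b (Suc k) *\<^sub>R es ! (2 * k + 1) \<and>
          B (es ! (2 * k + 1)) = b (Suc k) *\<^sub>R es ! (2 * k))))" (is "_ \<longleftrightarrow> ?M")
  proof -
    have *: "(represented_by (restrict J H) es
          (diag_block_mat (map (\<lambda>i. mat_of_rows_list 2 [[0, -1], [1, 0]]) [1..<n])) \<and>
        represented_by (restrict (br U) H) es
          (diag_block_mat (map (\<lambda>i. mat_of_rows_list 2 [[0, a i], [- a i, 0]]) [1..<n])) \<and>
        represented_by (restrict (br (J U)) H) es
          (diag_block_mat (map (\<lambda>i. mat_of_rows_list 2 [[0, b i], [- b i, 0]]) [1..<n]))) \<longleftrightarrow>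
      (\<forall>k<n - 1.
        (J (es ! (2 * k)) = es ! (2 * k + 1) \<and> J (es ! (2 * k + 1)) = - es ! (2 * k)) \<and>
        (A (es ! (2 * k)) = - a (Suc k) *\<^sub>R es ! (2 * k + 1) \<and>
          A (es ! (2 * k + 1)) = a (Suc k) *\<^sub>R es ! (2 * k)) \<and>
        (B (es ! (2 * k)) = - b (Suc k) *\<^sub>R es ! (2 * k + 1) \<and>
          B (es ! (2 * k + 1)) = b (Suc k) *\<^sub>R es ! (2 * k)))"
      if len: "length es = 2 * (n - 1)" and es: "orthonormal_basis inner H es" for es a b
      by (simp only: represented_by_offdiagonal_blocks_on_H[OF len es restrict_apply'[of _ H J]]
          represented_by_offdiagonal_blocks_on_H[OF len es restrict_br_H(1)]
          represented_by_offdiagonal_blocks_on_H[OF len es restrict_br_H(2)]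
          scaleR_one scaleR_minus_left imp_conjR all_conj_distrib)
    show ?thesis unfolding n2 using * by (intro iff_exI) blast
  qed
  also have "?M \<longleftrightarrow> unitary_action"
  proof
    assume ?M
    then obtain es a b where len: "length es = 2 * (n - 1)" and es: "orthonormal_basis inner H es"
      and eqs: "\<And>k. k < n - 1 \<Longrightarrow> J (es ! (2 * k)) = es ! (2 * k + 1)"
        "\<And>k. k < n - 1 \<Longrightarrow> A (es ! (2 * k)) = - a (Suc k) *\<^sub>R es ! (2 * k + 1)"
        "\<And>k. k < n - 1 \<Longrightarrow> A (es ! (2 * k + 1)) = a (Suc k) *\<^sub>R es ! (2 * k)"
        "\<And>k. k < n - 1 \<Longrightarrow> B (es ! (2 * k)) = - b (Suc k) *\<^sub>R es ! (2 * k + 1)"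
        "\<And>k. k < n - 1 \<Longrightarrow> B (es ! (2 * k + 1)) = b (Suc k) *\<^sub>R es ! (2 * k)"
      by blast
    show unitary_action
      unfolding unitary_action_def
      using skew_complex_of_blocks[where c = "\<lambda>k. a (Suc k)",
          OF linear_A A_in_H A_P es len eqs(1) eqs(2) eqs(3)]
        skew_complex_of_blocks[where c = "\<lambda>k. b (Suc k)",
          OF linear_B B_in_H B_P es len eqs(1) eqs(4) eqs(5)]
      by blast
  next
    assume unitary: unitary_action
    note A_J = A_J[OF Z_H unitary] and B_J = B_J[OF Z_H unitary]
    have "\<exists>m es \<alpha> \<beta>. length es = 2 * m \<and> orthonormal_basis inner H es \<and>
      (\<forall>k<m. es ! (2 * k + 1) = J (es ! (2 * k)) \<and>
         J (A (es ! (2 * k))) = \<alpha> k *\<^sub>R es ! (2 * k) \<and> J (B (es ! (2 * k))) = \<beta> k *\<^sub>R es ! (2 * k))"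
    proof (rule adapted_orthonormal_basis_exists)
      show "linear (\<lambda>x. J (A x))" "linear (\<lambda>x. J (B x))"
        using linear_compose[OF linear_A linJ] linear_compose[OF linear_B linJ]
        by (simp_all add: comp_def)
      show "inner (J (A x)) y = inner x (J (A y))" "inner (J (B x)) y = inner x (J (B y))" for x y
        using JA_sym[OF Z_H unitary, of x y] JB_sym[OF Z_H unitary, of x y]
        by (simp_all add: inner_commute)
      show "J (A (J (B x))) = J (B (J (A x)))" for x
        by (simp add: A_J B_J A_B_commute[OF Z_H])
    qed (simp_all add: subspace_H J_H A_J B_J)
    then obtain m es \<alpha> \<beta> where len: "length es = 2 * m" and es: "orthonormal_basis inner H es"
      and eig: "\<And>k. k < m \<Longrightarrow> es ! (2 * k + 1) = J (es ! (2 * k))"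
        "\<And>k. k < m \<Longrightarrow> J (A (es ! (2 * k))) = \<alpha> k *\<^sub>R es ! (2 * k)"
        "\<And>k. k < m \<Longrightarrow> J (B (es ! (2 * k))) = \<beta> k *\<^sub>R es ! (2 * k)"
      by blast
    have m: "m = n - 1"
      using orthonormal_basis_length[OF es] len dim by simp
    have "J (es ! (2 * k)) = es ! (2 * k + 1) \<and> J (es ! (2 * k + 1)) = - es ! (2 * k)"
      "A (es ! (2 * k)) = - \<alpha> k *\<^sub>R es ! (2 * k + 1) \<and> A (es ! (2 * k + 1)) = \<alpha> k *\<^sub>R es ! (2 * k)"
      "B (es ! (2 * k)) = - \<beta> k *\<^sub>R es ! (2 * k + 1) \<and> B (es ! (2 * k + 1)) = \<beta> k *\<^sub>R es ! (2 * k)"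
      if "k < n - 1" for k
    proof -
      have k: "k < m" using that m by simp
      have neg: "x = - y" if "- x = y" for x y :: 'g using that by auto
      have "A (es ! (2 * k)) = - (\<alpha> k *\<^sub>R J (es ! (2 * k)))"
        "B (es ! (2 * k)) = - (\<beta> k *\<^sub>R J (es ! (2 * k)))"
        using arg_cong[OF eig(2)[OF k], of J] arg_cong[OF eig(3)[OF k], of J]
        by (auto intro: neg)
      then show "J (es ! (2 * k)) = es ! (2 * k + 1) \<and> J (es ! (2 * k + 1)) = - es ! (2 * k)"
        "A (es ! (2 * k)) = - \<alpha> k *\<^sub>R es ! (2 * k + 1) \<and> A (es ! (2 * k + 1)) = \<alpha> k *\<^sub>R es ! (2 * k)"
        "B (es ! (2 * k)) = - \<beta> k *\<^sub>R es ! (2 * k + 1) \<and> B (es ! (2 * k + 1)) = \<beta> k *\<^sub>R es ! (2 * k)"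
        unfolding eig(1)[OF k] by (simp_all add: A_J B_J)
    qed
    \<comment> \<open>Block \<open>i\<close> belongs to pair \<open>i - 1\<close>.\<close>
    then show ?M
      using len es unfolding m
      by (intro exI[of _ es] exI[of _ "\<lambda>i. \<alpha> (i - 1)"] exI[of _ "\<lambda>i. \<beta> (i - 1)"] conjI) simp_all
  qed
  finally show ?thesis .
qed

lemma bracket_span_complement_iff_Z:
  assumes HU: "orthogonal_comp H = span {U, J U}"
  shows "bracket_span br (orthogonal_comp H) (orthogonal_comp H) = {0} \<longleftrightarrow> Z = 0"
proof
  assume *: "bracket_span br (orthogonal_comp H) (orthogonal_comp H) = {0}"
  have "U \<in> orthogonal_comp H" "J U \<in> orthogonal_comp H"
    unfolding HU by (simp_all add: span_base)
  then have "br U (J U) \<in> {br x y |x y. x \<in> orthogonal_comp H \<and> y \<in> orthogonal_comp H}"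
    by blast
  then have "Z \<in> bracket_span br (orthogonal_comp H) (orthogonal_comp H)"
    unfolding bracket_span_def Z_def by (rule span_base)
  then show "Z = 0" using * by simp
next
  assume Z0: "Z = 0"
  have P0: "P x = 0" if x: "x \<in> orthogonal_comp H" for x
  proof -
    obtain a b where "x = a *\<^sub>R U + b *\<^sub>R J U"
      using x unfolding HU by (rule span_pairE)
    then show ?thesis by (simp add: P_def)
  qed
  have AB0: "A x = 0" "B x = 0" if "x \<in> orthogonal_comp H" for x
    by (simp_all add: A_def B_def P0[OF that] br_simps)
  have "br x y = 0" if "x \<in> orthogonal_comp H" "y \<in> orthogonal_comp H" for x y
    by (simp add: br_eq[of x y] Z0 AB0 that)
  then have "{br x y |x y. x \<in> orthogonal_comp H \<and> y \<in> orthogonal_comp H} \<subseteq> {0}" by blast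
  then have "bracket_span br (orthogonal_comp H) (orthogonal_comp H) \<subseteq> {0}"
    unfolding bracket_span_def by (rule span_minimal) simp
  moreover have "0 \<in> bracket_span br (orthogonal_comp H) (orthogonal_comp H)"
    unfolding bracket_span_def by (rule span_zero)
  ultimately show "bracket_span br (orthogonal_comp H) (orthogonal_comp H) = {0}" by blast
qed

end

section \<open>The classification\<close>

theorem corollary2p3:
  fixes br :: "'g::euclidean_space \<Rightarrow> 'g \<Rightarrow> 'g"
    and J :: "'g \<Rightarrow> 'g"
    and \<h> :: "'g set"
    and U :: 'g
    and A B J\<^sub>\<h> :: "'g \<Rightarrow> 'g"
    and n :: nat
  assumes "lie_bracket br"
    and "lie_solvable br"
    and "DIM('g) = 2 * n"
    and "is_nilradical br \<h>"
    and "\<forall>x\<in>\<h>. \<forall>y\<in>\<h>. br x y = 0"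
    and "dim \<h> + 2 = DIM('g)"
    and "almost_hermitian J inner"
    and "J ` \<h> = \<h>"
    and "orthonormal_basis inner (orthogonal_comp \<h>) [U, J U]"
    and "A = restrict (br U) \<h>"
    and "B = restrict (br (J U)) \<h>"
    and "J\<^sub>\<h> = restrict J \<h>"
  defines "cond_i \<equiv>
      A \<in> so_on inner \<h> \<and> B \<in> so_on inner \<h> \<and>
      (\<forall>x\<in>\<h>. commutator A J\<^sub>\<h> x = 0) \<and> (\<forall>x\<in>\<h>. commutator B J\<^sub>\<h> x = 0)"
    and "cond_ii \<equiv>
      (\<exists>es. length es = 2 * n - 2 \<and> orthonormal_basis inner \<h> es \<and>
        (\<exists>a b :: nat \<Rightarrow> real.
          represented_by J\<^sub>\<h> es
            (diag_block_mat (map (\<lambda>i. mat_of_rows_list 2 [[0, -1], [1, 0]]) [1..<n])) \<and>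
          represented_by A es
            (diag_block_mat (map (\<lambda>i. mat_of_rows_list 2 [[0, a i], [- a i, 0]]) [1..<n])) \<and>
          represented_by B es
            (diag_block_mat (map (\<lambda>i. mat_of_rows_list 2 [[0, b i], [- b i, 0]]) [1..<n]))))"
  shows "(skt br J inner \<longleftrightarrow> cond_i) \<and>
    (cond_i \<longleftrightarrow> cond_ii) \<and>
    (skt br J inner \<longrightarrow>
      (kaehler br J inner \<longleftrightarrow>
        bracket_span br (orthogonal_comp \<h>) (orthogonal_comp \<h>) = {0}) \<and>
      (lie_center br \<inter> \<h> = {0} \<longrightarrow> (\<exists>g. kaehler_metric br J g)))"
proof -
  note lie = assms(1)[unfolded lie_bracket_def]
  note herm = assms(7)[unfolded almost_hermitian_def hermitian_inner_product_def]
  have ideal: "lie_ideal br \<h>"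
    using assms(4) by (simp add: is_nilradical_def nilpotent_ideal_def)
  have sub: "subspace \<h>" using ideal by (simp add: lie_ideal_def)
  have comp: "span {U, J U} = orthogonal_comp \<h>"
    using assms(9) by (simp add: orthonormal_basis_def)
  have on: "inner ([U, J U] ! i) ([U, J U] ! j) = (if i = j then 1 else 0)" if "i < 2" "j < 2" for i j
    using assms(9) that by (simp add: orthonormal_basis_def numeral_2_eq_2)
  have UU: "inner U U = 1" "inner U (J U) = 0" "inner (J U) (J U) = 1" "inner (J U) U = 0"
    using on[of 0 0] on[of 0 1] on[of 1 1] on[of 1 0] by simp_all
  have perp: "inner x w = 0" if "x \<in> \<h>" "w \<in> orthogonal_comp \<h>" for x w
    using that by (auto simp: orthogonal_comp_def Linear_Algebra.orthogonal_def inner_commute)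
  \<comment> \<open>The double orthogonal complement of \<open>\<h>\<close> is \<open>\<h>\<close>.\<close>
  have complement: "x - inner x U *\<^sub>R U - inner x (J U) *\<^sub>R J U \<in> \<h>" (is "?p \<in> _") for x
  proof -
    have "inner w ?p = 0" if w: "w \<in> span {U, J U}" for w
    proof -
      obtain a b where "w = a *\<^sub>R U + b *\<^sub>R J U"
        using w by (rule span_pairE)
      then show ?thesis
        by (simp add: inner_add_left inner_diff_right UU inner_commute[of x])
    qed
    then have "?p \<in> orthogonal_comp (orthogonal_comp \<h>)"
      unfolding comp[symmetric] by (simp add: orthogonal_comp_def Linear_Algebra.orthogonal_def)
    then show ?thesis by (simp add: orthogonal_comp_self[OF sub])
  qed
  have U: "U \<in> orthogonal_comp \<h>" unfolding comp[symmetric] by (simp add: span_base)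
  interpret abelian_ideal_codim2 J br \<h> U
  proof (intro abelian_ideal_codim2.intro orthogonal_complex_structure.intro
      abelian_ideal_codim2_axioms.intro)
    show "linear J" "J (J x) = - x" "inner (J x) (J y) = inner x y" for x y
      using herm by blast+
    show "bilinear br" "br x x = 0" "br x (br y z) + br y (br z x) + br z (br x y) = 0" for x y z
      using lie by blast+
    show "br x y \<in> \<h>" if "y \<in> \<h>" for x y using ideal that by (simp add: lie_ideal_def)
    show "br x y = 0" if "x \<in> \<h>" "y \<in> \<h>" for x y using assms(5) that by blast
    show "J x \<in> \<h>" if "x \<in> \<h>" for x using assms(8) that by blast
    show "inner x U = 0" if "x \<in> \<h>" for x by (rule perp[OF that U])
  qed (rule sub UU(1) complement)+
  have Z: "Z \<in> \<h>" by (rule Z_in_nilradical[OF assms(4)])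
  have "dim \<h> = 2 * (n - 1)" using assms(3,6) by simp
  note cond_ii = cond_ii_iff_unitary_action[OF Z this, folded assms(10,11,12)]
  note cond_i = cond_i_iff_unitary_action[folded assms(10,11,12)]
  have skt: "skt br J inner \<longleftrightarrow> unitary_action"
    using skt_imp_unitary_action[OF Z] skt_unitary[OF Z] by blast
  have "kaehler br J inner \<longleftrightarrow> bracket_span br (orthogonal_comp \<h>) (orthogonal_comp \<h>) = {0}"
    if unitary_action
    using kaehler_iff_Z[OF Z that] bracket_span_complement_iff_Z[OF comp[symmetric]] by simp
  moreover have "\<exists>g. kaehler_metric br J g" if unitary_action "lie_center br \<inter> \<h> = {0}"
    using shear_exists[OF Z that] kaehler_metric_sheared[OF Z that(1)] by blast
  ultimately show ?thesis
    unfolding cond_i_def cond_ii_def cond_i cond_ii skt by blast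
qed

end
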